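(* Let $\theta=(f,\lambda,G)$ and $\hat\theta=(\hat f,\hat\lambda,\hat G)$ be two smooth exponential-family graphical latent models with the same base measures $h_i$ and the same sufficient statistics $s_i:\mathbb R\to\mathbb R$ (so the sufficient statistics are one-dimensional, $k=1$). Assume: 0. (a) $\theta\sim_{\rm obs}\hat\theta$; (b) each $s_i$ is minimal, i.e. not constant on $\mathbb R$; (c) (sufficient variability) there exist $(z_{(r)},a_{(r)})$, $r=0,1,\dots,d_z$, each of the form $z_{(r)}\in\mathbb R^{d_z\times(t_{(r)}-1)}$, $a_{(r)}\in\mathcal A^{t_{(r)}}$ for some $t_{(r)}\in[T]$, such that the vectors $\lambda(z_{(r)},a_{(r)})-\lambda(z_{(0)},a_{(0)})\in\mathbb R^{d_z}$, $r=1,\dots,d_z$, are linearly independent. 1. The map $s:\mathbb R^{d_z}\to\mathbb R^{d_z}$, $s(z)=(s_1(z_1),\dots,s_{d_z}(z_{d_z}))$, is a diffeomorphism from $\mathbb R^{d_z}$ onto $s(\mathbb R^{d_z})$. 2. (Sufficient influence of $z$) $Ds(z)$ is invertible for all $z$, and there exist $(z_{(r)},a_{(r)},\tau_{(r)})$, $r=1,\dots,\|G^z\|_0$, with $z_{(r)}\in\mathbb R^{d_z\times(t_{(r)}-1)}$, $a_{(r)}\in\mathcal A^{t_{(r)}}$ for some $t_{(r)}\in[T]$ and $1\le\tau_{(r)}<t_{(r)}$, such that $$\mathrm{span}\Big\{D^{\tau_{(r)}}_z\lambda(z_{(r)},a_{(r)})\,Ds\big(z_{(r)}^{\tau_{(r)}}\big)^{-1}\Big\}_{r=1}^{\|G^z\|_0}=\mathbb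 R^{d_z\times d_z}_{G^z},$$ where $D^{\tau}_z\lambda(z^{<t},a^{<t})\in\mathbb R^{d_z\times d_z}$ is the Jacobian of $\lambda$ with respect to the column $z^\tau$ of $z^{<t}$, and $z_{(r)}^{\tau_{(r)}}$ is the $\tau_{(r)}$-th column of $z_{(r)}$. Then there exists a $d_z\times d_z$ permutation matrix $P$ such that $PG^zP^\top\subseteq\hat G^z$. If in addition 3. (Sparsity) $\|\hat G^z\|_0\le\|G^z\|_0$, then $\theta\sim^z_{\rm con}\hat\theta$ and $\theta\sim_{\rm lin}\hat\theta$, which together imply that $v:=f^{-1}\circ\hat f$ satisfies $$v(z)=s^{-1}\big(CP^\top s(z)+b\big)\quad\text{for all }z\in\mathbb R^{d_z},$$ where $P$ is a permutation matrix, $b\in\mathbb R^{d_z}$, and $C\in\mathbb R^{d_z\times d_z}$ is invertible, $G^z$-preserving and $(G^z)^\top$-preserving.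
   Context: **Notation.** $[n]=\{1,\dots,n\}$. Fix positive integers $T,d_x,d_z,d_a$ with $d_z\le d_x$, a constant $\sigma^2\ge0$ and a nonempty set $\mathcal A\subseteq\mathbb R^{d_a}$. Write $z^{<t}=(z^1,\dots,z^{t-1})\in\mathbb R^{d_z\times(t-1)}$ and $a^{<t}=(a^0,\dots,a^{t-1})\in\mathcal A^t$ (columns indexed by time). For binary matrices, $A\subseteq B$ means every nonzero position of $A$ is a nonzero position of $B$; $\|A\|_0$ is the number of nonzero entries. For $B\in\{0,1\}^{m\times n}$, $\mathbb R^{m\times n}_B=\{M\in\mathbb R^{m\times n}:B_{i,j}=0\Rightarrow M_{i,j}=0\}$. A map defined on an arbitrary subset of $\mathbb R^n$ is $C^k$ if it extends to a $C^k$ map on an open set containing that subset. A diffeomorphism is a $C^1$ bijection with $C^1$ inverse. A permutation matrix is identified with the linear map it defines. **Graphical latent model.** A triple $\theta=(f,p,G)$, $G=[G^z,G^a]$, $G^z\in\{0,1\}^{d_z\times d_z}$, $G^a\in\{0,1\}^{d_z\times d_a}$, such that: (i) $f:\mathbb R^{d_z}\to\mathbb R^{d_x}$ is a diffeomorphism onto its image, and $f(\mathbb R^{d_z})$ is closed in $\mathbb R^{d_x}$; observations are $x^t=f(z^t)+n^t$, $t\in[T]$, where the $n^t\sim\mathcal N(0,\sigma^2I)$ are independent across time and independent of all $z$'s and $a$'s; (ii) for each $t\in[T]$, the latent vector $z^t$ has, given $z^{<t}$ and $a^{<t}$, a conditional density with respect to Lebesgue measure $p(z^t\mid z^{<t},a^{<t})=\prod_{i=1}^{d_z}p(z^t_i\mid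 z^{<t},a^{<t})$, each factor being strictly positive on $\mathbb R$ (for $t=1$ the conditioning is on $a^0$ only); (iii) for each $i$ and $t$, $p(z^t_i\mid z^{<t},a^{<t})$ depends on $(z^{<t},a^{<t})$ only through the rows $z_j^{<t}$ with $G^z_{i,j}=1$ and the rows $a_\ell^{<t}$ with $G^a_{i,\ell}=1$. **Smooth** means: either $a$ is continuous, in which case $\mathcal A$ is regular closed ($\overline{\mathcal A^\circ}=\mathcal A$) and each $p(z_i^t\mid z^{<t},a^{<t})$ is $C^2$ on $\mathbb R\times\mathbb R^{d_z\times(t-1)}\times\mathcal A^t$; or $a$ is discrete, in which case for each fixed $a^{<t}$ it is $C^2$ on $\mathbb R\times\mathbb R^{d_z\times(t-1)}$. **Exponential family ($k=1$).** The model is exponential-family if for all $i$ and $t$, $p(z_i^t\mid z^{<t},a^{<t})=h_i(z_i^t)\exp\{s_i(z_i^t)\lambda_i(z^{<t},a^{<t})-\psi_i(z^{<t},a^{<t})\}$, with $h_i:\mathbb R\to(0,\infty)$ and $s_i:\mathbb R\to\mathbb R$ fixed and known, $\lambda_i$ real-valued and $\psi_i$ the normalizer; $\lambda=(\lambda_1,\dots,\lambda_{d_z})$. Such a model is written $\theta=(f,\lambda,G)$. **Observational equivalence.** $\theta\sim_{\rm obs}\tilde\theta$ iff for every $a^{<T}\in\mathcal A^T$ the conditional distributions of $(x^1,\dots,x^T)$ given $a^{<T}$ induced by $\theta$ and $\tilde\theta$ (same $\sigma^2$) coincide. **Equivalence up to diffeomorphism.** $\theta\sim_{\rm diff}\tilde\theta$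 iff $f(\mathbb R^{d_z})=\tilde f(\mathbb R^{d_z})$ and, with $v:=f^{-1}\circ\tilde f$ (a diffeomorphism of $\mathbb R^{d_z}$), for all $t\in[T]$, $a^{<t}\in\mathcal A^t$, $z^{\le t}\in\mathbb R^{d_z\times t}$: $\tilde p(z^t\mid z^{<t},a^{<t})=p(v(z^t)\mid v(z^{<t}),a^{<t})\,|\det Dv(z^t)|$, where $v$ is applied columnwise to $z^{<t}$. **Quasi-linear equivalence ($k=1$).** $\theta\sim_{\rm lin}\tilde\theta$ iff $\theta\sim_{\rm diff}\tilde\theta$ and there are an invertible $L\in\mathbb R^{d_z\times d_z}$ and $b\in\mathbb R^{d_z}$ with $s(v(z))=Ls(z)+b$ for all $z\in\mathbb R^{d_z}$, where $v=f^{-1}\circ\tilde f$. **Dependency graph and $G$-preservation.** The dependency graph of $h:\mathbb R^n\to\mathbb R^m$ is $H\in\{0,1\}^{m\times n}$ with $H_{i,j}=0$ iff $h_i$ does not depend on its $j$-th argument. For $B\in\{0,1\}^{m\times n}$, a matrix $C\in\mathbb R^{m\times m}$ is $B$-preserving if $C^\top\mathbb R^{m\times n}_B\subseteq\mathbb R^{m\times n}_B$; a function $c:\mathbb R^m\to\mathbb R^m$ is $B$-preserving if its dependency graph is a $B$-preserving matrix. **$z$-consistency.** $\theta\sim^z_{\rm con}\tilde\theta$ iff there is a permutation matrix $P$ such that $\theta\sim_{\rm diff}\tilde\theta$, $\tilde G^z=PG^zP^\top$, and $v=f^{-1}\circ\tilde f$ can be written $v=c\circ P^\top$ with $c$ a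 diffeomorphism that is both $G^z$-preserving and $(G^z)^\top$-preserving. *)

theory Defs
  imports "HOL-Probability.Probability"
begin

section \<open>Maps of class \<open>C\<^sup>k\<close>\<close>

text \<open>On open sets, \<open>C\<^sup>k\<close> is defined through iterated directional derivatives, which in
  finite dimension agrees with continuity of the iterated Frechet derivative.\<close>

primrec Ck_open :: "nat \<Rightarrow> 'a::euclidean_space set \<Rightarrow> ('a \<Rightarrow> 'b::real_normed_vector) \<Rightarrow> bool" where
  "Ck_open 0 U f \<longleftrightarrow> continuous_on U f"
| "Ck_open (Suc k) U f \<longleftrightarrow>
     (\<forall>x\<in>U. f differentiable (at x)) \<and> (\<forall>v. Ck_open k U (\<lambda>x. frechet_derivative f (at x) v))"

definition Ck_on :: "nat \<Rightarrow> 'a::euclidean_space set \<Rightarrow> ('a \<Rightarrow> 'b::real_normed_vector) \<Rightarrow> bool" where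
  "Ck_on k S f \<longleftrightarrow> (\<exists>U g. open U \<and> S \<subseteq> U \<and> Ck_open k U g \<and> (\<forall>x\<in>S. g x = f x))"

definition diffeo :: "'a::euclidean_space set \<Rightarrow> 'b::euclidean_space set \<Rightarrow> ('a \<Rightarrow> 'b) \<Rightarrow> bool" where
  "diffeo S S' f \<longleftrightarrow> bij_betw f S S' \<and> Ck_on 1 S f \<and> Ck_on 1 S' (inv_into S f)"

section \<open>Binary matrices\<close>

text \<open>Binary matrices are real matrices with entries in \<open>{0, 1}\<close>, so that products such as
  \<open>P ** G ** transpose P\<close> are ordinary matrix products.\<close>

definition binary_mat :: "real^'n^'m \<Rightarrow> bool" where
  "binary_mat B \<longleftrightarrow> (\<forall>i j. B$i$j \<in> {0, 1})"

definition mat_le :: "real^'n^'m \<Rightarrow> real^'n^'m \<Rightarrow> bool"  (infix \<open>\<subseteq>\<^sub>m\<close> 50) where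
  "A \<subseteq>\<^sub>m B \<longleftrightarrow> (\<forall>i j. A$i$j \<noteq> 0 \<longrightarrow> B$i$j \<noteq> 0)"

definition norm0 :: "real^'n^'m \<Rightarrow> nat" where
  "norm0 A = card {(i, j). A$i$j \<noteq> 0}"

definition mat_space :: "real^'n^'m \<Rightarrow> (real^'n^'m) set" where
  "mat_space B = {M. \<forall>i j. B$i$j = 0 \<longrightarrow> M$i$j = 0}"

definition permutation_mat :: "real^'n^'n \<Rightarrow> bool" where
  "permutation_mat P \<longleftrightarrow> (\<exists>\<pi>. bij \<pi> \<and> P = (\<chi> i j. if i = \<pi> j then 1 else 0))"

definition dependency_graph :: "(real^'n \<Rightarrow> real^'m) \<Rightarrow> real^'n^'m" where
  "dependency_graph h =
     (\<chi> i j. if \<exists>x y. (\<forall>k. k \<noteq> j \<longrightarrow> x$k = y$k) \<and> h x $ i \<noteq> h y $ i then 1 else 0)"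

definition preserving_mat :: "real^'n^'m \<Rightarrow> real^'m^'m \<Rightarrow> bool" where
  "preserving_mat B C \<longleftrightarrow> (\<lambda>M. transpose C ** M) ` mat_space B \<subseteq> mat_space B"

definition preserving_fun :: "real^'n^'m \<Rightarrow> (real^'m \<Rightarrow> real^'m) \<Rightarrow> bool" where
  "preserving_fun B c \<longleftrightarrow> preserving_mat B (dependency_graph c)"

section \<open>Graphical latent models\<close>

text \<open>The finite linear order \<open>'T\<close> stands for \<open>{1, \<dots>, T}\<close>, and \<open>'dz\<close>, \<open>'dx\<close>, \<open>'da\<close> index the
  coordinates of the latents, observations and actions. Trajectories are full matrices
  \<open>z :: real^'dz^'T\<close>, \<open>a :: real^'da^'T\<close> with columns indexed by time: \<open>z$t\<close> is the latent
  vector at time \<open>t\<close>, whereas \<open>a$t\<close> is the action at time \<open>t - 1\<close>. The history before \<open>t\<close>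
  (latents at times \<open>1, \<dots>, t - 1\<close>, actions at times \<open>0, \<dots>, t - 1\<close>) thus consists of the columns
  \<open>z$s\<close> with \<open>s < t\<close> and \<open>a$s\<close> with \<open>s \<le> t\<close>; a function of it is a function of full trajectories that
  ignores all other columns.

  \<open>dens \<theta> t i x z a\<close> is the conditional density of \<open>z$t$i\<close> at \<open>x\<close> given the history before
  \<open>t\<close> recorded in \<open>z\<close> and \<open>a\<close>.\<close>

record ('dx, 'dz, 'da, 'T) latent_model =
  mixing :: "real^'dz \<Rightarrow> real^'dx"
  dens :: "'T \<Rightarrow> 'dz \<Rightarrow> real \<Rightarrow> real^'dz^'T \<Rightarrow> real^'da^'T \<Rightarrow> real"
  Gz :: "real^'dz^'dz"
  Ga :: "real^'da^'dz"

definition action_seqs :: "(real^'da) set \<Rightarrow> (real^'da^'T) set" where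
  "action_seqs A = {a. \<forall>t. a$t \<in> A}"

text \<open>The last conjunct is the graph condition; the restrictions \<open>s < t\<close> and \<open>s \<le> t\<close> in it also
  say that \<open>dens \<theta> t\<close> is a function of the history before \<open>t\<close>.\<close>

definition graphical_model ::
  "(real^'da) set \<Rightarrow> ('dx::finite, 'dz::finite, 'da::finite, 'T::{finite,linorder}) latent_model \<Rightarrow> bool"
where
  "graphical_model A \<theta> \<longleftrightarrow>
     diffeo UNIV (range (mixing \<theta>)) (mixing \<theta>) \<and> closed (range (mixing \<theta>)) \<and>
     binary_mat (Gz \<theta>) \<and> binary_mat (Ga \<theta>) \<and>
     (\<forall>t i. \<forall>a\<in>action_seqs A.
        (\<lambda>(x, z). dens \<theta> t i x z a) \<in> borel_measurable borel \<and>
        (\<forall>x z. dens \<theta> t i x z a > 0) \<and>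
        (\<forall>z. (\<integral>\<^sup>+ x. ennreal (dens \<theta> t i x z a) \<partial>lborel) = 1)) \<and>
     (\<forall>t i x z z'. \<forall>a\<in>action_seqs A. \<forall>a'\<in>action_seqs A.
        (\<forall>s<t. \<forall>j. Gz \<theta> $ i $ j = 1 \<longrightarrow> z$s$j = z'$s$j) \<longrightarrow>
        (\<forall>s\<le>t. \<forall>l. Ga \<theta> $ i $ l = 1 \<longrightarrow> a$s$l = a'$s$l) \<longrightarrow>
        dens \<theta> t i x z a = dens \<theta> t i x z' a')"

text \<open>The first disjunct is the case of a continuous, the second that of a discrete action
  variable; the latter means that only countably many values are possible.\<close>

definition smooth_model ::
  "(real^'da) set \<Rightarrow> ('dx::finite, 'dz::finite, 'da::finite, 'T::{finite,linorder}) latent_model \<Rightarrow> bool"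
where
  "smooth_model A \<theta> \<longleftrightarrow>
     closure (interior A) = A \<and>
       (\<forall>t i. Ck_on 2 (UNIV \<times> UNIV \<times> action_seqs A) (\<lambda>(x, z, a). dens \<theta> t i x z a)) \<or>
     countable A \<and>
       (\<forall>t i. \<forall>a\<in>action_seqs A. Ck_on 2 UNIV (\<lambda>(x, z). dens \<theta> t i x z a))"

definition log_normalizer :: "(real \<Rightarrow> real) \<Rightarrow> (real \<Rightarrow> real) \<Rightarrow> real \<Rightarrow> real" where
  "log_normalizer h s l = ln (\<integral>x. h x * exp (s x * l) \<partial>lborel)"

definition exponential_family ::
  "(real^'da) set \<Rightarrow> ('dz \<Rightarrow> real \<Rightarrow> real) \<Rightarrow> ('dz \<Rightarrow> real \<Rightarrow> real)
    \<Rightarrow> ('T \<Rightarrow> real^'dz^'T::_ \<Rightarrow> real^'da^'T::_ \<Rightarrow> real^'dz)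
    \<Rightarrow> ('dx::finite, 'dz::finite, 'da::finite, 'T::{finite,linorder}) latent_model \<Rightarrow> bool"
where
  "exponential_family A h s lam \<theta> \<longleftrightarrow>
     (\<forall>i x. h i x > 0) \<and>
     (\<forall>t z z'. \<forall>a\<in>action_seqs A. \<forall>a'\<in>action_seqs A.
        (\<forall>r<t. z$r = z'$r) \<longrightarrow> (\<forall>r\<le>t. a$r = a'$r) \<longrightarrow> lam t z a = lam t z' a') \<and>
     (\<forall>t i x z. \<forall>a\<in>action_seqs A.
        dens \<theta> t i x z a =
          h i x * exp (s i x * lam t z a $ i - log_normalizer (h i) (s i) (lam t z a $ i)))"

definition apply_coords :: "('n \<Rightarrow> real \<Rightarrow> real) \<Rightarrow> real^'n \<Rightarrow> real^'n" where
  "apply_coords s z = (\<chi> i. s i (z$i))"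

text \<open>Jacobian with respect to the column \<open>z$u\<close> of the history.\<close>

definition column_jacobian ::
  "('T \<Rightarrow> real^'dz^'T \<Rightarrow> real^'da^'T \<Rightarrow> real^'dz)
    \<Rightarrow> 'T \<Rightarrow> 'T \<Rightarrow> real^'dz^'T \<Rightarrow> real^'da^'T \<Rightarrow> real^'dz^'dz"
where
  "column_jacobian lam u t z a =
     jacobian (\<lambda>w. lam t (\<chi> r. if r = u then w else z$r) a) (at (z$u))"

section \<open>Equivalence of models\<close>

text \<open>Law of the noise matrix \<open>(n\<^sup>1, \<dots>, n\<^sup>T)\<close>: \<open>sqrt \<sigma>2\<close> times a matrix of independent
  standard normals, which is the point mass at \<open>0\<close> if \<open>\<sigma>2 = 0\<close>.\<close>

definition noise_law :: "real \<Rightarrow> (real^'dx^'T) measure" where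
  "noise_law \<sigma>2 =
     distr (density lborel (\<lambda>e. ennreal (\<Prod>t\<in>UNIV. \<Prod>k\<in>UNIV. std_normal_density (e$t$k))))
       borel (\<lambda>e. sqrt \<sigma>2 *\<^sub>R e)"

text \<open>Law of the latent trajectory given the actions, by the chain rule.\<close>

definition latent_law ::
  "('dx::finite, 'dz::finite, 'da::finite, 'T::{finite,linorder}) latent_model
    \<Rightarrow> real^'da^'T::_ \<Rightarrow> (real^'dz^'T::_) measure"
where
  "latent_law \<theta> a =
     density lborel (\<lambda>z. ennreal (\<Prod>t\<in>UNIV. \<Prod>i\<in>UNIV. dens \<theta> t i (z$t$i) z a))"

definition obs_law ::
  "real \<Rightarrow> ('dx::finite, 'dz::finite, 'da::finite, 'T::{finite,linorder}) latent_model
    \<Rightarrow> real^'da^'T::_ \<Rightarrow> (real^'dx^'T::_) measure"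
where
  "obs_law \<sigma>2 \<theta> a =
     distr (latent_law \<theta> a \<Otimes>\<^sub>M noise_law \<sigma>2) borel (\<lambda>(z, n). \<chi> t. mixing \<theta> (z$t) + n$t)"

definition obs_equiv ::
  "(real^'da) set \<Rightarrow> real
    \<Rightarrow> ('dx::finite, 'dz::finite, 'da::finite, 'T::{finite,linorder}) latent_model
    \<Rightarrow> ('dx, 'dz, 'da, 'T) latent_model \<Rightarrow> bool"
where
  "obs_equiv A \<sigma>2 \<theta> \<theta>' \<longleftrightarrow> (\<forall>a\<in>action_seqs A. obs_law \<sigma>2 \<theta> a = obs_law \<sigma>2 \<theta>' a)"

text \<open>The map \<open>f\<^sup>-\<^sup>1 \<circ> f'\<close>; only meaningful if \<open>f\<close> and \<open>f'\<close> have the same image.\<close>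

definition transition ::
  "('dx::finite, 'dz::finite, 'da::finite, 'T::{finite,linorder}) latent_model
    \<Rightarrow> ('dx, 'dz, 'da, 'T) latent_model \<Rightarrow> real^'dz \<Rightarrow> real^'dz"
where
  "transition \<theta> \<theta>' = inv (mixing \<theta>) \<circ> mixing \<theta>'"

definition diff_equiv ::
  "(real^'da) set
    \<Rightarrow> ('dx::finite, 'dz::finite, 'da::finite, 'T::{finite,linorder}) latent_model
    \<Rightarrow> ('dx, 'dz, 'da, 'T) latent_model \<Rightarrow> bool"
where
  "diff_equiv A \<theta> \<theta>' \<longleftrightarrow>
     range (mixing \<theta>) = range (mixing \<theta>') \<and>
     (let v = transition \<theta> \<theta>' in
       \<forall>t z. \<forall>a\<in>action_seqs A.
         (\<Prod>i\<in>UNIV. dens \<theta>' t i (z$t$i) z a) =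
         (\<Prod>i\<in>UNIV. dens \<theta> t i (v (z$t) $ i) (\<chi> r. v (z$r)) a) *
           \<bar>det (jacobian v (at (z$t)))\<bar>)"

definition lin_equiv ::
  "(real^'da) set \<Rightarrow> ('dz \<Rightarrow> real \<Rightarrow> real)
    \<Rightarrow> ('dx::finite, 'dz::finite, 'da::finite, 'T::{finite,linorder}) latent_model
    \<Rightarrow> ('dx, 'dz, 'da, 'T) latent_model \<Rightarrow> bool"
where
  "lin_equiv A s \<theta> \<theta>' \<longleftrightarrow>
     diff_equiv A \<theta> \<theta>' \<and>
     (\<exists>L b. invertible L \<and>
        (\<forall>z. apply_coords s (transition \<theta> \<theta>' z) = L *v apply_coords s z + b))"

definition z_consistent ::
  "(real^'da) set
    \<Rightarrow> ('dx::finite, 'dz::finite, 'da::finite, 'T::{finite,linorder}) latent_model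
    \<Rightarrow> ('dx, 'dz, 'da, 'T) latent_model \<Rightarrow> bool"
where
  "z_consistent A \<theta> \<theta>' \<longleftrightarrow>
     (\<exists>P. permutation_mat P \<and> diff_equiv A \<theta> \<theta>' \<and>
        Gz \<theta>' = P ** Gz \<theta> ** transpose P \<and>
        (\<exists>c. diffeo UNIV UNIV c \<and> preserving_fun (Gz \<theta>) c \<and>
           preserving_fun (transpose (Gz \<theta>)) c \<and>
           transition \<theta> \<theta>' = c \<circ> (\<lambda>z. transpose P *v z)))"

section \<open>Variability conditions\<close>

definition sufficient_variability ::
  "(real^'da) set
    \<Rightarrow> ('T::{finite,linorder} \<Rightarrow> real^'dz^'T::_ \<Rightarrow> real^'da^'T::_ \<Rightarrow> real^'dz) \<Rightarrow> bool"
where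
  "sufficient_variability A lam \<longleftrightarrow>
     (\<exists>(t :: nat \<Rightarrow> 'T) (z :: nat \<Rightarrow> real^'dz^'T::_) (a :: nat \<Rightarrow> real^'da^'T::_).
        (\<forall>r\<in>{0..CARD('dz)}. a r \<in> action_seqs A) \<and>
        (let w = (\<lambda>r. lam (t r) (z r) (a r) - lam (t 0) (z 0) (a 0)) in
           inj_on w {1..CARD('dz)} \<and> independent (w ` {1..CARD('dz)})))"

definition sufficient_influence_z ::
  "(real^'da) set \<Rightarrow> ('dz \<Rightarrow> real \<Rightarrow> real)
    \<Rightarrow> ('T::{finite,linorder} \<Rightarrow> real^'dz^'T::_ \<Rightarrow> real^'da^'T::_ \<Rightarrow> real^'dz)
    \<Rightarrow> real^'dz^'dz \<Rightarrow> bool"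
where
  "sufficient_influence_z A s lam G \<longleftrightarrow>
     (\<forall>z. invertible (jacobian (apply_coords s) (at z))) \<and>
     (\<exists>(t :: nat \<Rightarrow> 'T) (u :: nat \<Rightarrow> 'T) (z :: nat \<Rightarrow> real^'dz^'T::_) (a :: nat \<Rightarrow> real^'da^'T::_).
        (\<forall>r\<in>{1..norm0 G}. a r \<in> action_seqs A \<and> u r < t r) \<and>
        span ((\<lambda>r. column_jacobian lam (u r) (t r) (z r) (a r) **
                   matrix_inv (jacobian (apply_coords s) (at (z r $ u r)))) ` {1..norm0 G})
          = mat_space G)"

end

theory Submission
  imports Defs
begin

text \<open>The characteristic function of the noise is nowhere zero, so observational equivalence gives equality
  of the laws of the noiseless observations. Comparing supports yields \<open>range f = range f'\<close>, and the
  change of variables \<open>v = f\<^sup>-\<^sup>1 \<circ> f'\<close> matches the joint latent densities; integrating out the columns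
  from the last to the first matches the conditional ones. Taking logarithms, the sufficient
  statistics and natural parameters satisfy
  \<open>s(w) \<bullet> \<lambda>'(z, a) = s(v w) \<bullet> \<lambda>(v z, a) + K(w) + N(z, a)\<close>. By variability of \<open>\<lambda>\<close> this forces
  \<open>s \<circ> v = L s + b\<close> and \<open>\<lambda>' = L\<^sup>T \<lambda> \<circ> v + c\<close>, and differentiating in a past latent shows that
  \<open>M \<mapsto> L\<^sup>T M L\<close> maps the matrices supported on \<open>G\<close> into those supported on \<open>G'\<close>. A permutation
  \<open>\<sigma>\<close> with all \<open>L i (\<sigma> i) \<noteq> 0\<close> exists as \<open>det L \<noteq> 0\<close>; testing on matrix units shows that \<open>\<sigma>\<close> embeds
  \<open>G\<close> into \<open>G'\<close>. Under sparsity the embedding is an equality, and then \<open>C = L P\<close> preserves \<open>G\<close>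
  from both sides.\<close>

section \<open>Maps of class \<open>C\<^sup>1\<close> and diffeomorphisms\<close>

text \<open>Equality of laws only yields identities almost everywhere; since both variability
  conditions concern individual points, continuity of the densities is used to make them pointwise.
  Those points are given for \<open>\<theta>\<close>, whose parameters enter at \<open>v z\<close>,
  so they are pulled back through \<open>v\<close> before use. In the logarithmic identity
  \<open>K\<close> sees only the current latent and \<open>N\<close> only the history, so a
  difference in one variable removes one unknown function. The exponential-family condition asks of
  \<open>lam\<close> neither differentiability nor dependence along \<open>Gz\<close>; both are
  inherited from the densities by comparing two points where \<open>s i\<close> differs. The factor
  \<open>Ds^-1\<close> in the influence condition is what makes the Jacobians transform by
  \<open>L\<close> alone: \<open>Ds(v) Dv = L Ds\<close> gives \<open>Dv Ds^-1 = Ds(v)^-1 L\<close>.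
  The transversal \<open>\<sigma>\<close> need not be unique and \<open>L\<close> may have further
  nonzero entries. These are controlled afterwards: \<open>C = L P\<close> has a nonzero diagonal,
  and a diagonal entry on one side of a two-sided support condition leaves a one-sided condition on
  the other.\<close>

lemma Ck_on_1_iff:
  "Ck_on 1 S f \<longleftrightarrow> (\<exists>U g. open U \<and> S \<subseteq> U \<and> (\<forall>x\<in>U. g differentiable (at x)) \<and>
     (\<forall>v. continuous_on U (\<lambda>x. frechet_derivative g (at x) v)) \<and> (\<forall>x\<in>S. g x = f x))"
  unfolding Ck_on_def One_nat_def Ck_open.simps conj_assoc ..

lemma Ck_on_cong:
  assumes "\<And>x. x \<in> S \<Longrightarrow> f x = g x"
  shows "Ck_on k S f \<longleftrightarrow> Ck_on k S g"
  using assms by (simp add: Ck_on_def cong: conj_cong)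

lemma Ck_on_1_UNIV_D:
  assumes "Ck_on 1 UNIV f"
  shows "f differentiable (at x)" and "continuous_on UNIV (\<lambda>x. frechet_derivative f (at x) v)"
proof -
  obtain U g where "open U" "UNIV \<subseteq> U" "\<forall>x\<in>U. g differentiable (at x)"
    "\<forall>v. continuous_on U (\<lambda>x. frechet_derivative g (at x) v)" "\<forall>x\<in>UNIV. g x = f x"
    using assms unfolding Ck_on_1_iff by blast
  moreover from this have "U = UNIV" "g = f" by auto
  ultimately show "f differentiable (at x)" "continuous_on UNIV (\<lambda>x. frechet_derivative f (at x) v)"
    by auto
qed

lemma Ck_on_1_continuous_on:
  assumes "Ck_on 1 S f"
  shows "continuous_on S f"
proof -
  obtain U g where U: "open U" "S \<subseteq> U" and g: "\<forall>x\<in>U. g differentiable (at x)"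
    and "\<forall>v. continuous_on U (\<lambda>x. frechet_derivative g (at x) v)"
    and eq: "\<forall>x\<in>S. g x = f x"
    using assms unfolding Ck_on_1_iff by blast
  have "continuous_on S g"
    by (meson U(2) continuous_at_imp_continuous_on differentiable_imp_continuous_within g subsetD)
  then show ?thesis by (rule continuous_on_eq) (simp add: eq)
qed

lemma Ck_on_1_compose:
  fixes f :: "'a::euclidean_space \<Rightarrow> 'b::euclidean_space" and g :: "'b \<Rightarrow> 'c::real_normed_vector"
  assumes f: "Ck_on 1 S f" and g: "Ck_on 1 S' g" and sub: "f ` S \<subseteq> S'"
  shows "Ck_on 1 S (g \<circ> f)"
proof -
  obtain U f' where U: "open U" "S \<subseteq> U" and df: "\<forall>x\<in>U. f' differentiable (at x)"
    and cf: "\<forall>v. continuous_on U (\<lambda>x. frechet_derivative f' (at x) v)"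
    and eqf: "\<forall>x\<in>S. f' x = f x"
    using f unfolding Ck_on_1_iff by blast
  obtain V g' where V: "open V" "S' \<subseteq> V" and dg: "\<forall>x\<in>V. g' differentiable (at x)"
    and cg: "\<forall>v. continuous_on V (\<lambda>x. frechet_derivative g' (at x) v)"
    and eqg: "\<forall>x\<in>S'. g' x = g x"
    using g unfolding Ck_on_1_iff by blast
  define W where "W = U \<inter> f' -` V"
  have contf: "continuous_on U f'"
    by (meson continuous_at_imp_continuous_on differentiable_imp_continuous_within df)
  have W: "open W"
    unfolding W_def Int_commute[of U] using contf U(1) V(1) by (simp add: continuous_on_open_vimage)
  have SW: "S \<subseteq> W"
    using U(2) V(2) sub eqf by (fastforce simp: W_def)
  have hd: "((g' \<circ> f') has_derivative
      (frechet_derivative g' (at (f' x)) \<circ> frechet_derivative f' (at x))) (at x)" if "x \<in> W" for x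
    using that df dg by (intro diff_chain_at) (auto simp: W_def frechet_derivative_works[symmetric])
  \<comment> \<open>The hypothesis on \<open>g'\<close> gives continuity of its derivative in a
    fixed direction only, while the direction in the chain rule moves with \<open>x\<close>.
    Expansion in the basis leaves fixed directions with continuous coefficients.\<close>
  have fd: "frechet_derivative (g' \<circ> f') (at x) v =
      (\<Sum>b\<in>Basis. (frechet_derivative f' (at x) v \<bullet> b) *\<^sub>R frechet_derivative g' (at (f' x)) b)"
    if "x \<in> W" for x v
  proof -
    have lin: "linear (frechet_derivative g' (at (f' x)))"
      using that dg by (intro linear_frechet_derivative) (auto simp: W_def)
    have "frechet_derivative (g' \<circ> f') (at x) v =
        frechet_derivative g' (at (f' x)) (frechet_derivative f' (at x) v)"
      using frechet_derivative_at[OF hd[OF that]] by (metis comp_apply)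
    also have "\<dots> = frechet_derivative g' (at (f' x))
        (\<Sum>b\<in>Basis. (frechet_derivative f' (at x) v \<bullet> b) *\<^sub>R b)"
      by (simp add: euclidean_representation)
    finally show ?thesis by (simp add: linear_sum[OF lin] linear_scale[OF lin])
  qed
  show ?thesis
  unfolding Ck_on_1_iff
  proof (intro exI[of _ W] exI[of _ "g' \<circ> f'"] conjI ballI allI W SW)
    show "(g' \<circ> f') differentiable (at x)" if "x \<in> W" for x
      using hd[OF that] by (auto simp: differentiable_def)
    fix v
    have "continuous_on W (\<lambda>x. \<Sum>b\<in>Basis. (frechet_derivative f' (at x) v \<bullet> b) *\<^sub>R
        frechet_derivative g' (at (f' x)) b)"
    proof (intro continuous_intros)
      show "continuous_on W (\<lambda>x. frechet_derivative f' (at x) v)"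
        using cf[rule_format] by (rule continuous_on_subset) (auto simp: W_def)
      show "continuous_on W (\<lambda>x. frechet_derivative g' (at (f' x)) b)" for b
        by (rule continuous_on_compose2[OF cg[rule_format] continuous_on_subset[OF contf]]) (auto simp: W_def)
    qed
    then show "continuous_on W (\<lambda>x. frechet_derivative (g' \<circ> f') (at x) v)"
      by (rule continuous_on_eq) (simp add: fd)
  next
    show "(g' \<circ> f') x = (g \<circ> f) x" if "x \<in> S" for x
      using that eqf eqg sub by auto
  qed
qed

lemma Ck_on_1_linear:
  fixes f :: "'a::euclidean_space \<Rightarrow> 'b::euclidean_space"
  assumes "linear f"
  shows "Ck_on 1 S f"
unfolding Ck_on_1_iff
proof (intro exI[of _ UNIV] exI[of _ f] conjI ballI allI)
  have *: "(f has_derivative f) (at x)" for x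
    using assms by (simp add: bounded_linear_imp_has_derivative linear_conv_bounded_linear)
  show "f differentiable (at x)" for x using * by (auto simp: differentiable_def)
  have "frechet_derivative f (at x) = f" for x
    using frechet_derivative_at[OF *] by simp
  then show "continuous_on UNIV (\<lambda>x. frechet_derivative f (at x) v)" for v by simp
qed auto

lemma diffeo_comp:
  assumes f: "diffeo S S' f" and g: "diffeo S' S'' g"
  shows "diffeo S S'' (g \<circ> f)"
proof -
  have bf: "bij_betw f S S'" and bg: "bij_betw g S' S''"
    using f g by (auto simp: diffeo_def)
  have bij: "bij_betw (g \<circ> f) S S''" using bf bg by (rule bij_betw_trans)
  have "inv_into S (g \<circ> f) y = (inv_into S f \<circ> inv_into S' g) y" if "y \<in> S''" for y
  proof -
    have y: "inv_into S' g y \<in> S'" "g (inv_into S' g y) = y"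
      using bg that by (auto simp: bij_betw_def inv_into_into f_inv_into_f)
    have x: "inv_into S f (inv_into S' g y) \<in> S" "f (inv_into S f (inv_into S' g y)) = inv_into S' g y"
      using bf y by (auto simp: bij_betw_def inv_into_into f_inv_into_f)
    show ?thesis
      unfolding comp_apply[of "inv_into S f"]
    proof (rule inv_into_f_eq)
      show "inj_on (g \<circ> f) S" using bij by (simp add: bij_betw_def)
    qed (use x y in simp_all)
  qed
  moreover have "Ck_on 1 S'' (inv_into S f \<circ> inv_into S' g)"
    using f g bij_betw_inv_into[OF bg]
    by (intro Ck_on_1_compose[of _ _ S']) (auto simp: diffeo_def bij_betw_def)
  ultimately have "Ck_on 1 S'' (inv_into S (g \<circ> f))"
    using Ck_on_cong[of S'' "inv_into S (g \<circ> f)"] by blast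
  moreover have "Ck_on 1 S (g \<circ> f)"
    using f g by (intro Ck_on_1_compose[of _ _ S']) (auto simp: diffeo_def bij_betw_def)
  ultimately show ?thesis using bij by (auto simp: diffeo_def)
qed

lemma diffeo_inv:
  assumes f: "diffeo S S' f"
  shows "diffeo S' S (inv_into S f)"
proof -
  have bf: "bij_betw f S S'" using f by (auto simp: diffeo_def)
  have "inv_into S' (inv_into S f) x = f x" if "x \<in> S" for x
    using bf that by (rule inv_into_inv_into_eq)
  then have "Ck_on 1 S (inv_into S' (inv_into S f))"
    using f Ck_on_cong[of S] unfolding diffeo_def by metis
  then show ?thesis using f bij_betw_inv_into[OF bf] by (auto simp: diffeo_def)
qed

lemma diffeo_linear:
  fixes f g :: "'a::euclidean_space \<Rightarrow> 'a"
  assumes "linear f" "linear g" "f \<circ> g = id" "g \<circ> f = id"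
  shows "diffeo UNIV UNIV f"
proof -
  have "bij f" using assms(3,4) o_bij by blast
  moreover have "inv f = g" by (simp add: assms inv_unique_comp)
  ultimately show ?thesis
    using assms Ck_on_1_linear by (auto simp: diffeo_def)
qed

text \<open>Differentiating \<open>inv v \<circ> v = id\<close> gives the Jacobian a left inverse.
  Its determinant is a polynomial in continuous entries. The last two facts make
  \<open>\<bar>det Dv\<bar>\<close> a positive continuous density.\<close>

lemma diffeo_UNIV_derivative:
  fixes v :: "real^'n \<Rightarrow> real^'n"
  assumes v: "diffeo UNIV UNIV v"
  shows "(v has_derivative (\<lambda>h. jacobian v (at x) *v h)) (at x)"
    and "invertible (jacobian v (at x))"
    and "continuous_on UNIV (\<lambda>x. \<bar>det (jacobian v (at x))\<bar>)"
proof -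
  have C: "Ck_on 1 UNIV v" "Ck_on 1 UNIV (inv v)" and bij: "bij v"
    using v by (auto simp: diffeo_def)
  show D: "(v has_derivative (\<lambda>h. jacobian v (at x) *v h)) (at x)" for x
    using jacobian_works Ck_on_1_UNIV_D(1)[OF C(1)] by blast
  have D': "(inv v has_derivative (\<lambda>h. jacobian (inv v) (at x) *v h)) (at x)" for x
    using jacobian_works Ck_on_1_UNIV_D(1)[OF C(2)] by blast
  have "((inv v \<circ> v) has_derivative ((*v) (jacobian (inv v) (at (v x))) \<circ> (*v) (jacobian v (at x)))) (at x)"
    by (rule diff_chain_at[OF D D'])
  moreover have "inv v \<circ> v = id" using bij by (simp add: bij_is_inj)
  moreover have "(id has_derivative id) (at x)" by (rule has_derivative_id)
  ultimately have "(*v) (jacobian (inv v) (at (v x))) \<circ> (*v) (jacobian v (at x)) = id"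
    by (metis has_derivative_unique)
  then have "jacobian (inv v) (at (v x)) *v (jacobian v (at x) *v h) = h" for h
    by (metis comp_apply id_apply)
  then have "jacobian (inv v) (at (v x)) ** jacobian v (at x) = mat 1"
    by (simp add: matrix_eq matrix_vector_mul_assoc)
  then show "invertible (jacobian v (at x))"
    using invertible_left_inverse by blast
  have "continuous_on UNIV (\<lambda>x. frechet_derivative v (at x) (axis j 1) $ i)" for i j
    using Ck_on_1_UNIV_D(2)[OF C(1)] by (intro continuous_intros)
  then have "continuous_on UNIV (\<lambda>x. jacobian v (at x))"
    unfolding jacobian_def matrix_def
    by (intro continuous_on_vec_lambda)
  then show "continuous_on UNIV (\<lambda>x. \<bar>det (jacobian v (at x))\<bar>)"
    unfolding det_def by (intro continuous_intros)
qed

lemma diffeo_transition: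
  assumes "diffeo UNIV (range (mixing \<theta>)) (mixing \<theta>)" "diffeo UNIV (range (mixing \<theta>')) (mixing \<theta>')"
    and "range (mixing \<theta>) = range (mixing \<theta>')"
  shows "diffeo UNIV UNIV (transition \<theta> \<theta>')"
proof -
  have "diffeo (range (mixing \<theta>)) UNIV (inv (mixing \<theta>))" by (rule diffeo_inv[OF assms(1)])
  moreover have "diffeo UNIV (range (mixing \<theta>)) (mixing \<theta>')" using assms(2,3) by simp
  ultimately show ?thesis unfolding transition_def by (intro diffeo_comp)
qed

section \<open>Lebesgue measure on tuples of vectors\<close>

lemma Basis_vec_image:
  "(Basis :: ('a::euclidean_space^'n) set) = (\<lambda>(i, b). axis i b) ` (UNIV \<times> Basis)"
  by (auto simp: Basis_vec_def image_iff)

lemma prod_Basis_vec: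
  fixes f :: "'a::euclidean_space^'n \<Rightarrow> 'b::comm_monoid_mult"
  shows "(\<Prod>b\<in>Basis. f b) = (\<Prod>i\<in>UNIV. \<Prod>b\<in>Basis. f (axis i b))"
proof -
  have "inj_on (\<lambda>(i, b). axis i b) ((UNIV :: 'n set) \<times> (Basis :: 'a set))"
    by (auto simp: inj_on_def axis_eq_axis)
  then show ?thesis
    by (simp add: Basis_vec_image prod.reindex prod.cartesian_product split_def)
qed

lemma measurable_vec_nth [measurable]:
  "(\<lambda>x :: 'a::euclidean_space^'n. x $ i) \<in> borel_measurable borel"
  by (intro borel_measurable_continuous_onI continuous_intros)

lemma measurable_vec_lambda:
  fixes f :: "'n::finite \<Rightarrow> 'c \<Rightarrow> 'a::euclidean_space"
  assumes "\<And>i. f i \<in> borel_measurable M"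
  shows "(\<lambda>x. \<chi> i. f i x) \<in> borel_measurable M"
  using assms by (subst borel_measurable_euclidean_space)
    (auto simp: Basis_vec_image inner_axis intro!: borel_measurable_inner)

text \<open>A box of tuples is a product of boxes, so both measures give it the same volume. This
  opens Fubini and product formulas on two levels: coordinates of one latent vector
  (\<open>'a = real\<close>) and columns of a trajectory (\<open>'a\<close> a vector space).\<close>

lemma lborel_vec:
  "(lborel :: ('a::euclidean_space^'n) measure) =
    distr (Pi\<^sub>M UNIV (\<lambda>_. lborel)) borel (\<lambda>f. \<chi> i. f i)"
proof (rule lborel_eqI)
  interpret product_sigma_finite "\<lambda>_ :: 'n. lborel :: 'a measure" by standard
  have m: "(\<lambda>f. \<chi> i. f i) \<in> borel_measurable (Pi\<^sub>M UNIV (\<lambda>_ :: 'n. lborel :: 'a measure))"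
    by (intro measurable_vec_lambda) measurable
  fix l u :: "'a^'n" assume le: "\<And>b. b \<in> Basis \<Longrightarrow> l \<bullet> b \<le> u \<bullet> b"
  have le': "l $ i \<bullet> b \<le> u $ i \<bullet> b" if "b \<in> Basis" for i b
    using le[of "axis i b"] that by (auto simp: Basis_vec_image inner_axis)
  have "(\<lambda>f. \<chi> i. f i) -` box l u = (\<Pi>\<^sub>E i\<in>UNIV. box (l $ i) (u $ i))"
    by (force simp: mem_box Basis_vec_image inner_axis PiE_def Pi_def)
  then have "emeasure (distr (Pi\<^sub>M UNIV (\<lambda>_. lborel)) borel (\<lambda>f. \<chi> i. f i)) (box l u) =
      emeasure (Pi\<^sub>M UNIV (\<lambda>_. lborel)) (\<Pi>\<^sub>E i\<in>UNIV. box (l $ i) (u $ i))"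
    by (subst emeasure_distr[OF m]) (auto simp: space_PiM)
  also have "\<dots> = (\<Prod>i\<in>UNIV. emeasure lborel (box (l $ i) (u $ i)))"
    by (intro emeasure_PiM) auto
  also have "\<dots> = (\<Prod>i\<in>UNIV. \<Prod>b\<in>Basis. (u $ i - l $ i) \<bullet> b)"
    by (subst prod_ennreal[symmetric])
       (auto intro!: prod_nonneg simp: le' inner_diff_left emeasure_lborel_box_eq)
  also have "\<dots> = (\<Prod>b\<in>Basis. (u - l) \<bullet> b)"
    by (simp add: prod_Basis_vec inner_axis)
  finally show "emeasure (distr (Pi\<^sub>M UNIV (\<lambda>_. lborel)) borel (\<lambda>f. \<chi> i. f i)) (box l u) =
      (\<Prod>b\<in>Basis. (u - l) \<bullet> b)" .
qed simp

lemma nn_integral_lborel_vec: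
  fixes F :: "'a::euclidean_space^'n \<Rightarrow> ennreal"
  assumes "F \<in> borel_measurable borel"
  shows "(\<integral>\<^sup>+z. F z \<partial>lborel) = (\<integral>\<^sup>+f. F (\<chi> i. f i) \<partial>Pi\<^sub>M UNIV (\<lambda>_. lborel))"
  using assms by (subst lborel_vec, subst nn_integral_distr) (auto intro!: measurable_vec_lambda)

lemma nn_integral_lborel_vec_prod:
  fixes g :: "'n::finite \<Rightarrow> 'a::euclidean_space \<Rightarrow> ennreal"
  assumes "\<And>i. g i \<in> borel_measurable borel"
  shows "(\<integral>\<^sup>+z. (\<Prod>i\<in>UNIV. g i (z $ i)) \<partial>lborel) = (\<Prod>i\<in>UNIV. \<integral>\<^sup>+x. g i x \<partial>lborel)"
proof -
  interpret product_sigma_finite "\<lambda>_ :: 'n. lborel :: 'a measure" by standard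
  have "(\<lambda>z. \<Prod>i\<in>UNIV. g i (z $ i)) \<in> borel_measurable borel"
    using assms by measurable
  then show ?thesis
    using assms by (simp add: nn_integral_lborel_vec product_nn_integral_prod)
qed

section \<open>Gaussian smoothing and characteristic functions\<close>

text \<open>The standard normal density on an arbitrary Euclidean space. It serves twice: as the
  noise before scaling, on matrices, and as the mollifier in the uniqueness proof for characteristic
  functions.\<close>

definition gauss_density :: "'a::euclidean_space \<Rightarrow> real" where
  "gauss_density x = (\<Prod>b\<in>Basis. std_normal_density (x \<bullet> b))"

abbreviation gauss_law :: "'a::euclidean_space measure" where
  "gauss_law \<equiv> density lborel (\<lambda>x. ennreal (gauss_density x))"

lemma gauss_density_nonneg: "0 \<le> gauss_density x"
  by (simp add: gauss_density_def prod_nonneg)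

lemma gauss_density_eq:
  "gauss_density (x :: 'a::euclidean_space) = (1 / sqrt (2 * pi)) ^ DIM('a) * exp (- (x \<bullet> x) / 2)"
proof -
  have "gauss_density x = (1 / sqrt (2 * pi)) ^ DIM('a) * (\<Prod>b\<in>Basis. exp (- ((x \<bullet> b)\<^sup>2) / 2))"
    by (simp add: gauss_density_def normal_density_def prod_dividef prod.distrib power_one_over divide_simps)
  also have "(\<Prod>b\<in>Basis. exp (- ((x \<bullet> b)\<^sup>2) / 2)) = exp (- (x \<bullet> x) / 2)"
    by (subst euclidean_inner) (simp add: exp_sum[symmetric] sum_negf sum_divide_distrib[symmetric] power2_eq_square)
  finally show ?thesis .
qed

lemma measurable_gauss_density [measurable]: "gauss_density \<in> borel_measurable borel"
  unfolding gauss_density_def by measurable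

lemma prob_space_gauss: "prob_space (gauss_law :: 'a::euclidean_space measure)"
proof
  have 1: "(\<integral>\<^sup>+x. ennreal (std_normal_density x) \<partial>lborel) = 1"
    using prob_space.emeasure_space_1[OF prob_space_normal_density[of 1 0]]
    by (simp add: emeasure_density)
  have "(\<integral>\<^sup>+x. ennreal (gauss_density (x :: 'a)) \<partial>lborel) = 1"
    unfolding gauss_density_def
    by (subst prod_ennreal[symmetric], simp, subst nn_integral_lborel_prod) (simp_all add: 1)
  then show "emeasure (gauss_law :: 'a measure) (space gauss_law) = 1"
    by (simp add: emeasure_density)
qed

lemma integral_lborel_prod:
  fixes f :: "'a::euclidean_space \<Rightarrow> real \<Rightarrow> complex"
  assumes "\<And>b. b \<in> Basis \<Longrightarrow> integrable lborel (f b)"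
  shows "(\<integral>x. (\<Prod>b\<in>Basis. f b (x \<bullet> b)) \<partial>lborel) = (\<Prod>b\<in>Basis. \<integral>x. f b x \<partial>lborel)"
proof -
  interpret product_sigma_finite "\<lambda>_ :: 'a. lborel :: real measure" by standard
  have [measurable]: "f b \<in> borel_measurable borel" if "b \<in> Basis" for b
    using assms[OF that] by simp
  have "(\<integral>x. (\<Prod>b\<in>Basis. f b (x \<bullet> b)) \<partial>lborel) =
      (\<integral>x. (\<Prod>b\<in>Basis. f b (x b)) \<partial>Pi\<^sub>M Basis (\<lambda>_. lborel))"
    by (subst lborel_eq, subst integral_distr) (auto simp: cong: prod.cong)
  also have "\<dots> = (\<Prod>b\<in>Basis. \<integral>x. f b x \<partial>lborel)"
    using assms by (intro product_integral_prod) auto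
  finally show ?thesis .
qed

lemma measurable_cis [measurable]: "cis \<in> borel_measurable borel"
  by (intro borel_measurable_continuous_onI continuous_intros)

text \<open>\<open>cis\<close> turns the inner product into a product over coordinates, so the
  integral factors into characteristic functions of the one-dimensional standard normal.\<close>

lemma gauss_charfn:
  fixes t :: "'a::euclidean_space"
  shows "(\<integral>x. cis (t \<bullet> x) \<partial>gauss_law) = complex_of_real (exp (- (t \<bullet> t) / 2))"
proof -
  have 1: "(\<integral>x. std_normal_density x *\<^sub>R cis (u * x) \<partial>lborel) = exp (- (u\<^sup>2) / 2)" for u :: real
    using fun_cong[OF char_std_normal_distribution, of u]
    by (simp add: char_def integral_density cis_conv_exp)
  have cis_sum: "cis (\<Sum>b\<in>B. g b) = (\<Prod>b\<in>B. cis (g b))" if "finite B" for B and g :: "'a \<Rightarrow> real"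
    using that by induction (simp_all add: cis_mult[symmetric])
  have "(\<integral>x. cis (t \<bullet> x) \<partial>gauss_law) = (\<integral>x. gauss_density x *\<^sub>R cis (t \<bullet> x) \<partial>lborel)"
    by (intro integral_density) (auto simp: gauss_density_nonneg)
  also have "\<dots> = (\<integral>x. (\<Prod>b\<in>Basis. std_normal_density (x \<bullet> b) *\<^sub>R cis ((t \<bullet> b) * (x \<bullet> b))) \<partial>lborel)"
    by (intro Bochner_Integration.integral_cong refl, subst euclidean_inner)
       (simp add: gauss_density_def cis_sum scaleR_conv_of_real prod.distrib)
  also have "\<dots> = (\<Prod>b\<in>Basis. \<integral>x. std_normal_density x *\<^sub>R cis ((t \<bullet> b) * x) \<partial>lborel)"
  proof (rule integral_lborel_prod)
    fix b :: 'a
    have "integrable lborel (\<lambda>x. std_normal_density x)"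
      by (rule integrable_normal_density) simp
    then show "integrable lborel (\<lambda>x. std_normal_density x *\<^sub>R cis ((t \<bullet> b) * x))"
      by (rule Bochner_Integration.integrable_bound) auto
  qed
  also have "\<dots> = (\<Prod>b\<in>Basis. complex_of_real (exp (- ((t \<bullet> b)\<^sup>2) / 2)))"
    by (simp only: 1)
  also have "\<dots> = complex_of_real (\<Prod>b\<in>Basis. exp (- ((t \<bullet> b)\<^sup>2) / 2))"
    by simp
  also have "(\<Prod>b\<in>Basis. exp (- ((t \<bullet> b)\<^sup>2) / 2)) = exp (- (t \<bullet> t) / 2)"
    by (subst (2) euclidean_inner) (simp add: exp_sum[symmetric] sum_negf sum_divide_distrib[symmetric] power2_eq_square)
  finally show ?thesis .
qed

text \<open>The Gaussian is its own Fourier transform, which expresses the smoothing of \<open>M\<close> at scale \<open>e\<close>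
  through the characteristic function of \<open>M\<close>.\<close>

lemma gauss_kernel_eq_charfn:
  fixes M :: "'a::euclidean_space measure"
  assumes "finite_measure M" and sets[measurable_cong]: "sets M = sets borel"
  shows "complex_of_real (\<integral>y. exp (- (((y - x) /\<^sub>R e) \<bullet> ((y - x) /\<^sub>R e)) / 2) \<partial>M) =
     (\<integral>t. cis (- (t \<bullet> x) / e) * (\<integral>y. cis ((t /\<^sub>R e) \<bullet> y) \<partial>M) \<partial>gauss_law)"
proof -
  interpret M: finite_measure M by fact
  interpret G: prob_space "gauss_law :: 'a measure" by (rule prob_space_gauss)
  interpret P: pair_sigma_finite "gauss_law :: 'a measure" M ..
  have "(\<lambda>(t, y). cis (t \<bullet> ((y - x) /\<^sub>R e))) \<in> borel_measurable (gauss_law \<Otimes>\<^sub>M M)"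
    by measurable
  moreover have "finite_measure ((gauss_law :: 'a measure) \<Otimes>\<^sub>M M)"
    by (rule finite_measure_pair_measure[OF M.finite_measure_axioms G.finite_measure_axioms])
  ultimately have int: "integrable (gauss_law \<Otimes>\<^sub>M M) (\<lambda>(t, y). cis (t \<bullet> ((y - x) /\<^sub>R e)))"
    by (intro finite_measure.integrable_const_bound[where B = 1]) auto
  have "complex_of_real (\<integral>y. exp (- (((y - x) /\<^sub>R e) \<bullet> ((y - x) /\<^sub>R e)) / 2) \<partial>M) =
      (\<integral>y. (\<integral>t. cis (t \<bullet> ((y - x) /\<^sub>R e)) \<partial>gauss_law) \<partial>M)"
    by (subst inner_commute) (simp only: gauss_charfn integral_complex_of_real)
  also have "\<dots> = (\<integral>t. (\<integral>y. cis (t \<bullet> ((y - x) /\<^sub>R e)) \<partial>M) \<partial>gauss_law)"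
    by (rule P.Fubini_integral[OF int])
  also have "\<dots> = (\<integral>t. cis (- (t \<bullet> x) / e) * (\<integral>y. cis ((t /\<^sub>R e) \<bullet> y) \<partial>M) \<partial>gauss_law)"
  proof (intro Bochner_Integration.integral_cong refl)
    fix t :: 'a
    have "cis (t \<bullet> ((y - x) /\<^sub>R e)) = cis (- (t \<bullet> x) / e) * cis ((t /\<^sub>R e) \<bullet> y)" for y
      by (simp add: cis_mult inner_diff_right divide_inverse algebra_simps)
    then show "(\<integral>y. cis (t \<bullet> ((y - x) /\<^sub>R e)) \<partial>M) =
        cis (- (t \<bullet> x) / e) * (\<integral>y. cis ((t /\<^sub>R e) \<bullet> y) \<partial>M)"
      by simp
  qed
  finally show ?thesis .
qed

lemma nn_integral_lborel_affine:
  fixes f :: "'a::euclidean_space \<Rightarrow> ennreal"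
  assumes [measurable]: "f \<in> borel_measurable borel" and "e > 0"
  shows "(\<integral>\<^sup>+x. f x \<partial>lborel) = ennreal (e ^ DIM('a)) * (\<integral>\<^sup>+x. f (y + e *\<^sub>R x) \<partial>lborel)"
proof -
  have "(\<integral>\<^sup>+x. f x \<partial>lborel) =
      (\<integral>\<^sup>+x. f x \<partial>density (distr lborel borel (\<lambda>x. y + e *\<^sub>R x)) (\<lambda>_. \<bar>e\<bar>^DIM('a)))"
    using assms by (subst lborel_affine[of e y]) auto
  also have "\<dots> = ennreal (e ^ DIM('a)) * (\<integral>\<^sup>+x. f (y + e *\<^sub>R x) \<partial>lborel)"
    using assms by (simp add: nn_integral_density nn_integral_distr nn_integral_cmult)
  finally show ?thesis .
qed

section \<open>Characteristic functions determine finite Borel measures\<close>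

lemma measure_eqI_continuous:
  fixes M N :: "'a::euclidean_space measure"
  assumes "finite_measure M" "finite_measure N" and sets: "sets M = sets borel" "sets N = sets borel"
    and eq: "\<And>g :: 'a \<Rightarrow> real. continuous_on UNIV g \<Longrightarrow> (\<And>x. 0 \<le> g x \<and> g x \<le> 1) \<Longrightarrow>
      (\<integral>\<^sup>+x. ennreal (g x) \<partial>M) = (\<integral>\<^sup>+x. ennreal (g x) \<partial>N)"
  shows "M = N"
proof -
  \<comment> \<open>Continuous functions with values in \<open>[0, 1]\<close> that decrease to the
    indicator of a nonempty closed set \<open>C\<close>. Dominated convergence then recovers the
    measure of \<open>C\<close>, and closed sets are an intersection-stable generator.\<close>
  define g where "g C k x = max 0 (1 - real k * infdist x C)" for C :: "'a set" and k x
  have lim: "(\<lambda>k. \<integral>\<^sup>+x. ennreal (g C k x) \<partial>L) \<longlonglongrightarrow> emeasure L C"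
    if C: "closed C" "C \<noteq> {}" and L: "finite_measure L" "sets L = sets borel" for C and L :: "'a measure"
  proof -
    have "(\<lambda>k. \<integral>\<^sup>+x. ennreal (g C k x) \<partial>L) \<longlonglongrightarrow> (\<integral>\<^sup>+x. indicator C x \<partial>L)"
    proof (rule nn_integral_dominated_convergence[where w = "\<lambda>_. 1"])
      have "continuous_on UNIV (g C k)" for k
        unfolding g_def by (intro continuous_intros)
      then have "g C k \<in> borel_measurable borel" for k
        by (rule borel_measurable_continuous_onI)
      then show "(\<lambda>x. ennreal (g C k x)) \<in> borel_measurable L" for k
        unfolding measurable_cong_sets[OF L(2) refl] by measurable
      show "AE x in L. ennreal (g C k x) \<le> 1" for k
        by (auto simp: g_def infdist_nonneg)
      show "(\<integral>\<^sup>+x. 1 \<partial>L) < \<infinity>"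
        using finite_measure.emeasure_finite[OF L(1)] by (simp add: less_top)
      show "AE x in L. (\<lambda>k. ennreal (g C k x)) \<longlonglongrightarrow> indicator C x"
      proof (rule AE_I2)
        fix x
        show "(\<lambda>k. ennreal (g C k x)) \<longlonglongrightarrow> indicator C x"
        proof (cases "x \<in> C")
          case True
          then show ?thesis using C by (simp add: g_def)
        next
          case False
          then have pos: "infdist x C > 0"
            using C infdist_pos_not_in_closed by blast
          obtain m :: nat where m: "1 < real m * infdist x C"
            using reals_Archimedean3[OF pos] by blast
          have "g C k x = 0" if "k \<ge> m" for k
          proof -
            have "real m * infdist x C \<le> real k * infdist x C"
              using that pos by (intro mult_right_mono) auto
            then show ?thesis using m by (simp add: g_def)
          qed
          then have "\<forall>\<^sub>F k in sequentially. ennreal (g C k x) = 0"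
            unfolding eventually_sequentially by (intro exI[of _ m]) simp
          then show ?thesis using False by (simp add: tendsto_eventually)
        qed
      qed
    qed (use C L in \<open>auto simp: measurable_cong_sets[OF L(2) refl]\<close>)
    then show ?thesis
      using C L by (simp add: nn_integral_indicator)
  qed
  show "M = N"
  proof (rule measure_eqI_generator_eq[where E = "Collect closed" and \<Omega> = UNIV and A = "\<lambda>_. UNIV"])
    fix C :: "'a set" assume "C \<in> Collect closed"
    then have C: "closed C" by simp
    show "emeasure M C = emeasure N C"
    \<comment> \<open>The empty set is split off because \<open>infdist x {} = 0\<close> would make
      every \<open>g C k\<close> equal to 1.\<close>
    proof (cases "C = {}")
      case False
      have "(\<integral>\<^sup>+x. ennreal (g C k x) \<partial>M) = (\<integral>\<^sup>+x. ennreal (g C k x) \<partial>N)" for k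
        by (intro eq) (auto simp: g_def infdist_nonneg intro!: continuous_intros)
      then show ?thesis
        using lim[OF C False assms(1) sets(1)] lim[OF C False assms(2) sets(2)] LIMSEQ_unique by simp
    qed simp
  qed (use sets assms(1) in \<open>auto simp: Int_stable_def borel_eq_closed finite_measure.emeasure_finite\<close>)
qed

text \<open>Averaging \<open>g\<close> over a Gaussian of scale \<open>e\<close> around
  \<open>y\<close> and then over \<open>y\<close> in \<open>M\<close> tends to the integral of
  \<open>g\<close> as \<open>e\<close> tends to 0. The substitution \<open>x = y + e u\<close>, with
  Jacobian factor \<open>e ^ DIM('a)\<close>, rewrites this average through the Gaussian smoothing
  of \<open>M\<close> at \<open>x\<close>, which depends on \<open>M\<close> only through its
  characteristic function.\<close>

lemma measure_eqI_charfn: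
  fixes M N :: "'a::euclidean_space measure"
  assumes M: "finite_measure M" "sets M = sets borel" and N: "finite_measure N" "sets N = sets borel"
    and eq: "\<And>t. (\<integral>x. cis (t \<bullet> x) \<partial>M) = (\<integral>x. cis (t \<bullet> x) \<partial>N)"
  shows "M = N"
proof (rule measure_eqI_continuous[OF M(1) N(1) M(2) N(2)])
  interpret G: prob_space "gauss_law :: 'a measure" by (rule prob_space_gauss)
  fix g :: "'a \<Rightarrow> real"
  assume cont: "continuous_on UNIV g" and g01: "\<And>x. 0 \<le> g x \<and> g x \<le> 1"
  have [measurable]: "g \<in> borel_measurable borel"
    using cont by (rule borel_measurable_continuous_onI)
  have smooth: "(\<integral>\<^sup>+y. (\<integral>\<^sup>+u. ennreal (g (y + e *\<^sub>R u)) \<partial>gauss_law) \<partial>L) =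
      ennreal (1 / e ^ DIM('a)) * (\<integral>\<^sup>+x. (\<integral>\<^sup>+y. ennreal (g x) *
        ennreal (gauss_density ((y - x) /\<^sub>R e)) \<partial>L) \<partial>lborel)"
    if L: "finite_measure L" "sets L = sets borel" and e: "e > 0" for L :: "'a measure" and e :: real
  proof -
    interpret L: finite_measure L by fact
    interpret P: pair_sigma_finite L "lborel :: 'a measure" ..
    note [measurable_cong] = L(2)
    have inner: "(\<integral>\<^sup>+u. ennreal (g (y + e *\<^sub>R u)) \<partial>gauss_law) =
        ennreal (1 / e ^ DIM('a)) * (\<integral>\<^sup>+x. ennreal (g x) * ennreal (gauss_density ((y - x) /\<^sub>R e)) \<partial>lborel)" for y
    proof -
      have "(\<integral>\<^sup>+x. ennreal (g x) * ennreal (gauss_density ((y - x) /\<^sub>R e)) \<partial>lborel) =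
          ennreal (e ^ DIM('a)) * (\<integral>\<^sup>+u. ennreal (g (y + e *\<^sub>R u)) *
            ennreal (gauss_density ((y - (y + e *\<^sub>R u)) /\<^sub>R e)) \<partial>lborel)"
        using e by (intro nn_integral_lborel_affine) auto
      \<comment> \<open>The argument simplifies to \<open>- u\<close>, and the Gaussian density is
        even.\<close>
      also have "(\<lambda>u. gauss_density ((y - (y + e *\<^sub>R u)) /\<^sub>R e)) = gauss_density"
        using e by (simp add: gauss_density_eq fun_eq_iff)
      also have "(\<integral>\<^sup>+u. ennreal (g (y + e *\<^sub>R u)) * ennreal (gauss_density u) \<partial>lborel) =
          (\<integral>\<^sup>+u. ennreal (g (y + e *\<^sub>R u)) \<partial>gauss_law)"
        by (subst nn_integral_density) (auto simp: mult.commute)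
      finally show ?thesis
        using e by (simp add: mult.assoc[symmetric] ennreal_mult'[symmetric])
    qed
    have "(\<integral>\<^sup>+y. (\<integral>\<^sup>+u. ennreal (g (y + e *\<^sub>R u)) \<partial>gauss_law) \<partial>L) = ennreal (1 / e ^ DIM('a)) *
        (\<integral>\<^sup>+y. (\<integral>\<^sup>+x. ennreal (g x) * ennreal (gauss_density ((y - x) /\<^sub>R e)) \<partial>lborel) \<partial>L)"
      unfolding inner by (rule nn_integral_cmult) measurable
    also have "(\<integral>\<^sup>+y. (\<integral>\<^sup>+x. ennreal (g x) * ennreal (gauss_density ((y - x) /\<^sub>R e)) \<partial>lborel) \<partial>L) =
        (\<integral>\<^sup>+x. (\<integral>\<^sup>+y. ennreal (g x) * ennreal (gauss_density ((y - x) /\<^sub>R e)) \<partial>L) \<partial>lborel)"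
      by (rule P.Fubini'[symmetric]) measurable
    finally show ?thesis .
  qed
  have lim: "(\<lambda>k. \<integral>\<^sup>+y. (\<integral>\<^sup>+u. ennreal (g (y + (1 / real (Suc k)) *\<^sub>R u)) \<partial>gauss_law) \<partial>L)
      \<longlonglongrightarrow> (\<integral>\<^sup>+y. ennreal (g y) \<partial>L)"
    if L: "finite_measure L" "sets L = sets borel" for L :: "'a measure"
  proof (rule nn_integral_dominated_convergence[where w = "\<lambda>_. 1"])
    note [measurable_cong] = L(2)
    show "(\<lambda>y. \<integral>\<^sup>+u. ennreal (g (y + (1 / real (Suc k)) *\<^sub>R u)) \<partial>gauss_law) \<in> borel_measurable L" for k
      by measurable
    show "(\<lambda>y. ennreal (g y)) \<in> borel_measurable L" by measurable
    show "AE y in L. (\<integral>\<^sup>+u. ennreal (g (y + (1 / real (Suc k)) *\<^sub>R u)) \<partial>gauss_law) \<le> 1" for k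
    proof (rule AE_I2)
      fix y
      have "(\<integral>\<^sup>+u. ennreal (g (y + (1 / real (Suc k)) *\<^sub>R u)) \<partial>gauss_law) \<le> (\<integral>\<^sup>+u. 1 \<partial>(gauss_law :: 'a measure))"
        using g01 by (intro nn_integral_mono) auto
      then show "(\<integral>\<^sup>+u. ennreal (g (y + (1 / real (Suc k)) *\<^sub>R u)) \<partial>gauss_law) \<le> 1"
        using G.emeasure_space_1 by simp
    qed
    show "(\<integral>\<^sup>+x. 1 \<partial>L) < \<infinity>"
      using finite_measure.emeasure_finite[OF L(1)] by (simp add: less_top)
    show "AE y in L. (\<lambda>k. \<integral>\<^sup>+u. ennreal (g (y + (1 / real (Suc k)) *\<^sub>R u)) \<partial>gauss_law)
        \<longlonglongrightarrow> ennreal (g y)"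
    proof (rule AE_I2)
      fix y
      have "(\<lambda>k. \<integral>\<^sup>+u. ennreal (g (y + (1 / real (Suc k)) *\<^sub>R u)) \<partial>gauss_law)
          \<longlonglongrightarrow> (\<integral>\<^sup>+u. ennreal (g y) \<partial>(gauss_law :: 'a measure))"
      proof (rule nn_integral_dominated_convergence[where w = "\<lambda>_. 1"])
        show "(\<integral>\<^sup>+x. 1 \<partial>(gauss_law :: 'a measure)) < \<infinity>"
          using G.emeasure_space_1 by simp
        show "AE u in gauss_law. (\<lambda>k. ennreal (g (y + (1 / real (Suc k)) *\<^sub>R u))) \<longlonglongrightarrow> ennreal (g y)"
        proof (rule AE_I2)
          fix u :: 'a
          have "(\<lambda>k. 1 / real (Suc k)) \<longlonglongrightarrow> 0"
            using LIMSEQ_inverse_real_of_nat by (simp add: inverse_eq_divide)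
          then have "(\<lambda>k. y + (1 / real (Suc k)) *\<^sub>R u) \<longlonglongrightarrow> y + 0 *\<^sub>R u"
            by (intro tendsto_intros)
          then have "(\<lambda>k. g (y + (1 / real (Suc k)) *\<^sub>R u)) \<longlonglongrightarrow> g y"
            using cont by (simp add: continuous_on_eq_continuous_at isCont_tendsto_compose[of y g])
          then show "(\<lambda>k. ennreal (g (y + (1 / real (Suc k)) *\<^sub>R u))) \<longlonglongrightarrow> ennreal (g y)"
            by (rule tendsto_ennrealI)
        qed
      qed (use g01 in auto)
      then show "(\<lambda>k. \<integral>\<^sup>+u. ennreal (g (y + (1 / real (Suc k)) *\<^sub>R u)) \<partial>gauss_law)
          \<longlonglongrightarrow> ennreal (g y)"
        using G.emeasure_space_1 by simp
    qed
  qed (simp_all add: measurable_cong_sets[OF L(2) refl])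
  have kernel_L: "(\<integral>\<^sup>+y. ennreal (g x) * ennreal (gauss_density ((y - x) /\<^sub>R e)) \<partial>L) =
      ennreal (g x * ((1 / sqrt (2 * pi)) ^ DIM('a) *
        (\<integral>y. exp (- (((y - x) /\<^sub>R e) \<bullet> ((y - x) /\<^sub>R e)) / 2) \<partial>L)))"
    if L: "finite_measure L" "sets L = sets borel" for L :: "'a measure" and x e
  proof -
    interpret L: finite_measure L by fact
    note [measurable_cong] = L(2)
    have "integrable L (\<lambda>y. exp (- (((y - x) /\<^sub>R e) \<bullet> ((y - x) /\<^sub>R e)) / 2))"
      by (intro L.integrable_const_bound[where B = 1]) (auto simp del: inner_scaleR_left inner_scaleR_right)
    then have "integrable L (\<lambda>y. gauss_density ((y - x) /\<^sub>R e))"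
      unfolding gauss_density_eq by (rule integrable_mult_right)
    then have "(\<integral>\<^sup>+y. ennreal (gauss_density ((y - x) /\<^sub>R e)) \<partial>L) =
        ennreal (\<integral>y. gauss_density ((y - x) /\<^sub>R e) \<partial>L)"
      by (intro nn_integral_eq_integral) (auto simp: gauss_density_nonneg)
    moreover have "(\<integral>\<^sup>+y. ennreal (g x) * ennreal (gauss_density ((y - x) /\<^sub>R e)) \<partial>L) =
        ennreal (g x) * (\<integral>\<^sup>+y. ennreal (gauss_density ((y - x) /\<^sub>R e)) \<partial>L)"
      by (rule nn_integral_cmult) measurable
    ultimately show ?thesis
      using g01[of x] by (simp add: gauss_density_eq ennreal_mult')
  qed
  have kernel: "(\<integral>\<^sup>+y. ennreal (g x) * ennreal (gauss_density ((y - x) /\<^sub>R e)) \<partial>M) =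
      (\<integral>\<^sup>+y. ennreal (g x) * ennreal (gauss_density ((y - x) /\<^sub>R e)) \<partial>N)" for x e
  proof -
    have "complex_of_real (\<integral>y. exp (- (((y - x) /\<^sub>R e) \<bullet> ((y - x) /\<^sub>R e)) / 2) \<partial>M) =
        complex_of_real (\<integral>y. exp (- (((y - x) /\<^sub>R e) \<bullet> ((y - x) /\<^sub>R e)) / 2) \<partial>N)"
      unfolding gauss_kernel_eq_charfn[OF M] gauss_kernel_eq_charfn[OF N] eq ..
    then have "(\<integral>y. exp (- (((y - x) /\<^sub>R e) \<bullet> ((y - x) /\<^sub>R e)) / 2) \<partial>M) =
        (\<integral>y. exp (- (((y - x) /\<^sub>R e) \<bullet> ((y - x) /\<^sub>R e)) / 2) \<partial>N)"
      by (simp only: of_real_eq_iff)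
    then show ?thesis
      unfolding kernel_L[OF M] kernel_L[OF N] by simp
  qed
  have "(\<integral>\<^sup>+y. (\<integral>\<^sup>+u. ennreal (g (y + (1 / real (Suc k)) *\<^sub>R u)) \<partial>gauss_law) \<partial>M) =
      (\<integral>\<^sup>+y. (\<integral>\<^sup>+u. ennreal (g (y + (1 / real (Suc k)) *\<^sub>R u)) \<partial>gauss_law) \<partial>N)" for k
  proof -
    have pos: "1 / real (Suc k) > 0" by simp
    show ?thesis unfolding smooth[OF M pos] smooth[OF N pos] kernel ..
  qed
  then show "(\<integral>\<^sup>+x. ennreal (g x) \<partial>M) = (\<integral>\<^sup>+x. ennreal (g x) \<partial>N)"
    using lim[OF M] lim[OF N] LIMSEQ_unique by simp
qed

section \<open>Removing independent noise\<close>

lemma charfn_noisy: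
  fixes F :: "'c \<Rightarrow> 'a::euclidean_space" and N :: "'a measure"
  assumes "prob_space M" "prob_space N"
    and [measurable]: "F \<in> borel_measurable M" and [measurable_cong]: "sets N = sets borel"
  shows "(\<integral>x. cis (t \<bullet> x) \<partial>distr (M \<Otimes>\<^sub>M N) borel (\<lambda>(z, n). F z + n)) =
    (\<integral>x. cis (t \<bullet> x) \<partial>distr M borel F) * (\<integral>x. cis (t \<bullet> x) \<partial>N)"
proof -
  interpret M: prob_space M by fact
  interpret N: prob_space N by fact
  interpret P: pair_prob_space M N ..
  have int: "integrable (M \<Otimes>\<^sub>M N) (\<lambda>(z, n). cis (t \<bullet> F z) * cis (t \<bullet> n))"
    by (intro P.integrable_const_bound[where B = 1]) (auto simp: norm_mult)
  have "(\<integral>x. cis (t \<bullet> x) \<partial>distr (M \<Otimes>\<^sub>M N) borel (\<lambda>(z, n). F z + n)) =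
      (\<integral>p. (case p of (z, n) \<Rightarrow> cis (t \<bullet> F z) * cis (t \<bullet> n)) \<partial>(M \<Otimes>\<^sub>M N))"
    by (subst integral_distr) (auto simp: inner_add_right cis_mult split_def)
  also have "\<dots> = (\<integral>z. (\<integral>n. cis (t \<bullet> F z) * cis (t \<bullet> n) \<partial>N) \<partial>M)"
    using P.integral_fst'[OF int] by simp
  also have "\<dots> = (\<integral>x. cis (t \<bullet> x) \<partial>distr M borel F) * (\<integral>x. cis (t \<bullet> x) \<partial>N)"
    by (simp add: integral_distr)
  finally show ?thesis .
qed

text \<open>Under independence the characteristic function of signal plus noise is a product. The
  noise factor is the same on both sides and nowhere zero, so it can be cancelled.\<close>

lemma distr_eq_if_noisy_distr_eq:
  fixes F F' :: "'c \<Rightarrow> 'a::euclidean_space" and N :: "'a measure"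
  assumes M: "prob_space M" "F \<in> borel_measurable M" and M': "prob_space M'" "F' \<in> borel_measurable M'"
    and N: "prob_space N" "sets N = sets borel" "\<And>t. (\<integral>x. cis (t \<bullet> x) \<partial>N) \<noteq> 0"
    and eq: "distr (M \<Otimes>\<^sub>M N) borel (\<lambda>(z, n). F z + n) = distr (M' \<Otimes>\<^sub>M N) borel (\<lambda>(z, n). F' z + n)"
  shows "distr M borel F = distr M' borel F'"
proof (rule measure_eqI_charfn)
  show "finite_measure (distr M borel F)" "finite_measure (distr M' borel F')"
    using M M' prob_space.prob_space_distr prob_space.finite_measure by blast+
  show "(\<integral>x. cis (t \<bullet> x) \<partial>distr M borel F) = (\<integral>x. cis (t \<bullet> x) \<partial>distr M' borel F')" for t
    using charfn_noisy[OF M(1) N(1) M(2) N(2), of t] charfn_noisy[OF M'(1) N(1) M'(2) N(2), of t] eq N(3)[of t]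
    by simp
qed simp_all

lemma noise_law_eq: "noise_law \<sigma>2 = distr (gauss_law :: (real^'dx^'k) measure) borel (\<lambda>e. sqrt \<sigma>2 *\<^sub>R e)"
  unfolding noise_law_def gauss_density_def prod_Basis_vec by (simp add: inner_axis)

lemma prob_space_noise_law: "prob_space (noise_law \<sigma>2 :: (real^'dx^'k) measure)"
  unfolding noise_law_eq by (rule prob_space.prob_space_distr[OF prob_space_gauss]) simp

text \<open>Scaling moves into the argument, where the Gaussian characteristic function is a real
  exponential. The degenerate law at \<open>\<sigma>2 = 0\<close> is included, with characteristic
  function 1.\<close>

lemma charfn_noise_law:
  assumes "\<sigma>2 \<ge> 0"
  shows "(\<integral>x. cis (t \<bullet> x) \<partial>(noise_law \<sigma>2 :: (real^'dx^'k) measure)) \<noteq> 0"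
proof -
  have "(\<integral>x. cis (t \<bullet> x) \<partial>(noise_law \<sigma>2 :: (real^'dx^'k) measure)) =
      (\<integral>x. cis ((sqrt \<sigma>2 *\<^sub>R t) \<bullet> x) \<partial>gauss_law)"
    unfolding noise_law_eq by (subst integral_distr) simp_all
  also have "\<dots> \<noteq> 0"
    unfolding gauss_charfn by simp
  finally show ?thesis .
qed

lemma obs_law_eqD:
  fixes \<theta> \<theta>' :: "('dx::finite, 'dz::finite, 'da::finite, 'T::{finite,linorder}) latent_model"
  assumes "\<sigma>2 \<ge> 0" and eq: "obs_law \<sigma>2 \<theta> a = obs_law \<sigma>2 \<theta>' a"
    and "prob_space (latent_law \<theta> a)" "prob_space (latent_law \<theta>' a)"
    and cont: "continuous_on UNIV (mixing \<theta>)" "continuous_on UNIV (mixing \<theta>')"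
  shows "distr (latent_law \<theta> a) borel (\<lambda>z. \<chi> t. mixing \<theta> (z$t)) =
    distr (latent_law \<theta>' a) borel (\<lambda>z. \<chi> t. mixing \<theta>' (z$t))"
proof (rule distr_eq_if_noisy_distr_eq)
  have "(\<lambda>z :: real^'dz^'T::_. \<chi> t. f (z$t)) \<in> borel_measurable borel"
    if "continuous_on UNIV f" for f :: "real^'dz \<Rightarrow> real^'dx"
    by (intro borel_measurable_continuous_onI continuous_on_vec_lambda continuous_on_compose2[OF that])
       (auto intro!: continuous_intros)
  then show "(\<lambda>z :: real^'dz^'T::_. \<chi> t. mixing \<theta> (z$t)) \<in> borel_measurable (latent_law \<theta> a)"
    "(\<lambda>z :: real^'dz^'T::_. \<chi> t. mixing \<theta>' (z$t)) \<in> borel_measurable (latent_law \<theta>' a)"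
    using cont by (simp_all add: latent_law_def)
  show "sets (noise_law \<sigma>2 :: (real^'dx^'T::_) measure) = sets borel"
    by (simp add: noise_law_def)
  have "(\<lambda>(z :: real^'dz^'T::_, n). (\<chi> t. f (z $ t)) + n) = (\<lambda>(z, n). \<chi> t. f (z $ t) + n $ t)"
    for f :: "real^'dz \<Rightarrow> real^'dx"
    by (auto simp: vec_eq_iff fun_eq_iff)
  then show "distr (latent_law \<theta> a \<Otimes>\<^sub>M noise_law \<sigma>2) borel (\<lambda>(z, n). (\<chi> t. mixing \<theta> (z $ t)) + n) =
      distr (latent_law \<theta>' a \<Otimes>\<^sub>M noise_law \<sigma>2) borel (\<lambda>(z, n). (\<chi> t. mixing \<theta>' (z $ t)) + n)"
    using eq by (simp add: obs_law_def)
qed (use assms charfn_noise_law prob_space_noise_law in auto)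

section \<open>Densities that factorize along time\<close>

text \<open>Induction over finite sets of times, each step adding a time \<open>b\<close> later than
  all others. No earlier factor sees column \<open>b\<close>, so it can be integrated innermost,
  where its own factor has mass 1.\<close>

lemma chain_rule_total_mass:
  fixes q :: "'T::{finite,linorder} \<Rightarrow> 'b::euclidean_space \<Rightarrow> 'b^'T::_ \<Rightarrow> ennreal"
  assumes meas[measurable]: "\<And>t. (\<lambda>(w, z). q t w z) \<in> borel_measurable borel"
    and dep: "\<And>t w z z'. (\<forall>s<t. z$s = z'$s) \<Longrightarrow> q t w z = q t w z'"
    and mass: "\<And>t z. (\<integral>\<^sup>+w. q t w z \<partial>lborel) = 1"
  shows "(\<integral>\<^sup>+z. (\<Prod>t\<in>UNIV. q t (z$t) z) \<partial>lborel) = 1"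
proof -
  interpret product_sigma_finite "\<lambda>_ :: 'T. lborel :: 'b measure" by standard
  have meas'[measurable]: "(\<lambda>(w, z). q t w z) \<in> borel_measurable (borel \<Otimes>\<^sub>M borel)" for t
    using meas by (simp add: borel_prod)
  \<comment> \<open>Columns outside \<open>S\<close> are set to \<open>0\<close>, since points of a product measure on \<open>S\<close> are undefined there.\<close>
  define ext where "ext S f = (\<chi> i. if i \<in> S then f i else 0)" for S and f :: "'T \<Rightarrow> 'b"
  have ext_meas[measurable]: "ext S \<in> borel_measurable (Pi\<^sub>M S' (\<lambda>_. lborel))" if "S \<subseteq> S'" for S S'
    unfolding ext_def
  proof (rule measurable_vec_lambda)
    show "(\<lambda>f. if i \<in> S then f i else 0) \<in> borel_measurable (Pi\<^sub>M S' (\<lambda>_. lborel))" for i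
      using that by (cases "i \<in> S") (auto intro!: measurable_component_singleton)
  qed
  have "(\<integral>\<^sup>+f. (\<Prod>t\<in>S. q t (f t) (ext S f)) \<partial>Pi\<^sub>M S (\<lambda>_. lborel)) = 1" if "finite S" for S
    using that
  proof (induction S rule: finite_linorder_max_induct)
    case empty
    then show ?case by (simp add: space_PiM)
  next
    case (insert b S)
    have b: "b \<notin> S" using insert.hyps by auto
    have [measurable]: "ext (insert b S) \<in> borel_measurable (Pi\<^sub>M (insert b S) (\<lambda>_. lborel))"
      "ext S \<in> borel_measurable (Pi\<^sub>M S (\<lambda>_. lborel))" by (auto intro: ext_meas)
    have split: "(\<Prod>t\<in>insert b S. q t ((f(b := y)) t) (ext (insert b S) (f(b := y)))) =
        (\<Prod>t\<in>S. q t (f t) (ext S f)) * q b y (ext S f)" for f y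
    proof -
      have "q t ((f(b := y)) t) (ext (insert b S) (f(b := y))) = q t (f t) (ext S f)" if "t \<in> S" for t
      proof -
        have "t < b" using that insert.hyps by blast
        then show ?thesis by (auto simp: ext_def intro!: dep)
      qed
      moreover have "q b y (ext (insert b S) (f(b := y))) = q b y (ext S f)"
        by (rule dep) (auto simp: ext_def)
      ultimately show ?thesis using b insert.hyps by (simp add: mult.commute)
    qed
    have "(\<integral>\<^sup>+f. (\<Prod>t\<in>insert b S. q t (f t) (ext (insert b S) f)) \<partial>Pi\<^sub>M (insert b S) (\<lambda>_. lborel)) =
        (\<integral>\<^sup>+f. (\<integral>\<^sup>+y. (\<Prod>t\<in>S. q t (f t) (ext S f)) * q b y (ext S f) \<partial>lborel) \<partial>Pi\<^sub>M S (\<lambda>_. lborel))"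
      unfolding split[symmetric] using insert.hyps b
      by (intro product_nn_integral_insert) (auto intro!: borel_measurable_prod)
    also have "\<dots> = (\<integral>\<^sup>+f. (\<Prod>t\<in>S. q t (f t) (ext S f)) \<partial>Pi\<^sub>M S (\<lambda>_. lborel))"
      by (simp add: nn_integral_cmult mass)
    finally show ?case using insert.IH by simp
  qed
  from this[of UNIV] show ?thesis
    by (subst nn_integral_lborel_vec) (simp_all add: ext_def)
qed

text \<open>Integrating out the later columns gives equal marginal densities of every initial
  segment of times. A conditional density is the quotient of two consecutive marginals.\<close>

lemma chain_rule_unique:
  fixes q r :: "'T::{finite,linorder} \<Rightarrow> 'b::euclidean_space \<Rightarrow> 'b^'T::_ \<Rightarrow> real"
  assumes meas: "\<And>t z. (\<lambda>w. q t w z) \<in> borel_measurable borel" "\<And>t z. (\<lambda>w. r t w z) \<in> borel_measurable borel"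
    and pos: "\<And>t w z. q t w z > 0" "\<And>t w z. r t w z > 0"
    and dep: "\<And>t w z z'. (\<forall>s<t. z$s = z'$s) \<Longrightarrow> q t w z = q t w z'"
      "\<And>t w z z'. (\<forall>s<t. z$s = z'$s) \<Longrightarrow> r t w z = r t w z'"
    and mass: "\<And>t z. (\<integral>\<^sup>+w. ennreal (q t w z) \<partial>lborel) = 1" "\<And>t z. (\<integral>\<^sup>+w. ennreal (r t w z) \<partial>lborel) = 1"
    and eq: "\<And>z. (\<Prod>t\<in>UNIV. q t (z$t) z) = (\<Prod>t\<in>UNIV. r t (z$t) z)"
  shows "q t (z$t) z = r t (z$t) z"
proof -
  \<comment> \<open>\<open>U\<close> holds the times already integrated out. The induction adds a
    new minimum \<open>b\<close>; upward closure of \<open>insert b U\<close> places all remaining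
    times before \<open>b\<close>, so that their factors do not involve column
    \<open>b\<close>.\<close>
  define up where "up U \<longleftrightarrow> (\<forall>x\<in>U. \<forall>y>x. y \<in> U)" for U :: "'T set"
  have main: "up U \<longrightarrow> (\<forall>z. (\<Prod>t\<in>-U. q t (z$t) z) = (\<Prod>t\<in>-U. r t (z$t) z))" if "finite U" for U
    using that
  proof (induction U rule: finite_linorder_min_induct)
    case empty
    then show ?case using eq by simp
  next
    case (insert b U)
    show ?case
    proof (intro impI allI)
      fix z :: "'b^'T::_"
      assume upb: "up (insert b U)"
      have "up U"
        unfolding up_def
      proof (intro ballI allI impI)
        fix x y assume "x \<in> U" "x < y"
        then have "y \<in> insert b U" "b < y" using upb insert.hyps unfolding up_def by auto
        then show "y \<in> U" by auto
      qed
      define V where "V = - insert b U"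
      have V: "-U = insert b V" "b \<notin> V" "finite V" using insert.hyps by (auto simp: V_def)
      have less: "t < b" if "t \<in> V" for t
        using that upb unfolding V_def up_def by (metis ComplD insertI1 insertCI linorder_neqE)
      define u where "u w = (\<chi> s. if s = b then w else z$s)" for w
      have int: "(\<integral>\<^sup>+w. ennreal (\<Prod>t\<in>-U. p t (u w$t) (u w)) \<partial>lborel) = ennreal (\<Prod>t\<in>V. p t (z$t) z)"
        if m: "(\<lambda>w. p b w z) \<in> borel_measurable borel" and p: "\<And>t w z. p t w z > 0"
          and d: "\<And>t w z z'. (\<forall>s<t. z$s = z'$s) \<Longrightarrow> p t w z = p t w z'"
          and i: "(\<integral>\<^sup>+w. ennreal (p b w z) \<partial>lborel) = 1"
        for p :: "'T \<Rightarrow> 'b \<Rightarrow> 'b^'T::_ \<Rightarrow> real"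
      proof -
        have "p t (u w$t) (u w) = p t (z$t) z" if "t \<in> V" for t w
        proof -
          have "u w $ t = z $ t" using that V by (auto simp: u_def)
          moreover have "p t x (u w) = p t x z" for x
            using less[OF that] by (intro d) (auto simp: u_def)
          ultimately show ?thesis by simp
        qed
        moreover have "p b (u w$b) (u w) = p b w z" for w
          using d[of b "u w" z w] by (simp add: u_def)
        ultimately have "(\<Prod>t\<in>-U. p t (u w$t) (u w)) = (\<Prod>t\<in>V. p t (z$t) z) * p b w z" for w
          using V by simp
        then show ?thesis
          using m p[THEN less_imp_le] i by (simp add: ennreal_mult' prod_nonneg nn_integral_cmult)
      qed
      have "ennreal (\<Prod>t\<in>V. q t (z$t) z) = ennreal (\<Prod>t\<in>V. r t (z$t) z)"
        using int[of q, OF meas(1) pos(1) dep(1) mass(1)] int[of r, OF meas(2) pos(2) dep(2) mass(2)]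
          insert.IH \<open>up U\<close> by simp
      then show "(\<Prod>t\<in>- insert b U. q t (z$t) z) = (\<Prod>t\<in>- insert b U. r t (z$t) z)"
        using pos[THEN less_imp_le] by (simp add: V_def[symmetric] prod_nonneg)
    qed
  qed
  \<comment> \<open>The complements of \<open>{t<..}\<close> and \<open>{t..}\<close> are the times
    up to \<open>t\<close> and those strictly before \<open>t\<close>. Their marginals differ
    exactly by the factor at \<open>t\<close>, and positivity permits division.\<close>
  have 1: "(\<Prod>s\<in>-{t<..}. q s (z$s) z) = (\<Prod>s\<in>-{t<..}. r s (z$s) z)"
    using main[of "{t<..}"] by (auto simp: up_def)
  have 2: "(\<Prod>s\<in>-{t..}. q s (z$s) z) = (\<Prod>s\<in>-{t..}. r s (z$s) z)"
    using main[of "{t..}"] by (auto simp: up_def)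
  have 3: "-{t<..} = insert t (-{t..})" "t \<notin> -{t..}" by auto
  have "r s (z$s) z \<noteq> 0" for s using pos(2)[of s "z$s" z] by simp
  then show ?thesis using 1 2 unfolding 3(1) by auto
qed

section \<open>Columnwise change of variables\<close>

text \<open>Change of variables as a push-forward identity. It suffices to test boxes: the integral
  of \<open>\<bar>det Dv\<bar>\<close> over the open preimage of a box is the volume of its image,
  which is the box itself.\<close>

lemma distr_diffeo_lborel:
  fixes v :: "real^'n::{finite,wellorder} \<Rightarrow> real^'n::_"
  assumes v: "diffeo UNIV UNIV v"
  shows "distr (density lborel (\<lambda>x. ennreal \<bar>det (jacobian v (at x))\<bar>)) borel v = lborel"
proof (rule lborel_eqI[symmetric])
  let ?J = "\<lambda>x. \<bar>det (jacobian v (at x))\<bar>"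
  note D = diffeo_UNIV_derivative[OF v]
  have bij: "bij v" using v by (simp add: diffeo_def)
  have cont: "continuous_on UNIV v"
    using v Ck_on_1_continuous_on by (auto simp: diffeo_def)
  then have [measurable]: "v \<in> borel_measurable borel" by (rule borel_measurable_continuous_onI)
  have J: "?J \<in> borel_measurable borel"
    using D(3) by (rule borel_measurable_continuous_onI)
  fix l u :: "real^'n::_" assume le: "\<And>b. b \<in> Basis \<Longrightarrow> l \<bullet> b \<le> u \<bullet> b"
  let ?S = "v -` box l u"
  have S: "open ?S" by (intro open_vimage open_box cont)
  have "v ` ?S = box l u" using bij by (simp add: bij_def image_vimage_eq)
  moreover have "inj_on v ?S" using bij by (meson bij_def inj_on_subset subset_UNIV)
  moreover have "(v has_derivative (\<lambda>h. jacobian v (at x) *v h)) (at x within ?S)" for x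
    using D(1) by (rule has_derivative_at_withinI)
  ultimately have "(?J has_integral measure lebesgue (box l u)) ?S"
    using has_measure_differentiable_image[of ?S v "\<lambda>x h. jacobian v (at x) *v h"] S by auto
  then have "(\<integral>\<^sup>+x. ennreal (?J x) * indicator ?S x \<partial>lborel) = ennreal (measure lebesgue (box l u))"
    by (intro nn_integral_has_integral_lebesgue') auto
  also have "\<dots> = (\<Prod>b\<in>Basis. (u - l) \<bullet> b)"
    using le by simp
  finally show "emeasure (distr (density lborel (\<lambda>x. ennreal (?J x))) borel v) (box l u) = (\<Prod>b\<in>Basis. (u - l) \<bullet> b)"
    using J S by (simp add: emeasure_distr emeasure_density)
qed simp

lemma nn_integral_diffeo:
  fixes v :: "real^'n::{finite,wellorder} \<Rightarrow> real^'n::_"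
  assumes v: "diffeo UNIV UNIV v" and [measurable]: "g \<in> borel_measurable borel"
  shows "(\<integral>\<^sup>+x. g (v x) * ennreal \<bar>det (jacobian v (at x))\<bar> \<partial>lborel) = (\<integral>\<^sup>+x. g x \<partial>lborel)"
proof -
  have [measurable]: "v \<in> borel_measurable borel"
    using v Ck_on_1_continuous_on by (auto simp: diffeo_def intro: borel_measurable_continuous_onI)
  have [measurable]: "(\<lambda>x. \<bar>det (jacobian v (at x))\<bar>) \<in> borel_measurable borel"
    using diffeo_UNIV_derivative(3)[OF v] by (rule borel_measurable_continuous_onI)
  show ?thesis
    by (subst (2) distr_diffeo_lborel[OF v, symmetric])
       (simp add: nn_integral_distr nn_integral_density mult.commute)
qed

text \<open>On a box both the density and the indicator factor over the columns, so the one-column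
  formula applies to each factor. This avoids computing the determinant of the block-diagonal
  Jacobian on trajectories.\<close>

lemma distr_columnwise_diffeo_lborel:
  fixes v :: "real^'n::{finite,wellorder} \<Rightarrow> real^'n::_"
  assumes v: "diffeo UNIV UNIV v"
  shows "distr (density lborel (\<lambda>z :: (real^'n::_)^'k. \<Prod>t\<in>UNIV. ennreal \<bar>det (jacobian v (at (z$t)))\<bar>))
    borel (\<lambda>z. \<chi> t. v (z$t)) = lborel"
proof (rule lborel_eqI[symmetric])
  let ?J = "\<lambda>x. ennreal \<bar>det (jacobian v (at x))\<bar>"
  have [measurable]: "v \<in> borel_measurable borel"
    using v Ck_on_1_continuous_on by (auto simp: diffeo_def intro: borel_measurable_continuous_onI)
  have V[measurable]: "(\<lambda>z :: (real^'n::_)^'k. \<chi> t. v (z$t)) \<in> borel_measurable borel"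
    by (intro measurable_vec_lambda) measurable
  have [measurable]: "?J \<in> borel_measurable borel"
    using diffeo_UNIV_derivative(3)[OF v]
    by (intro measurable_compose[OF borel_measurable_continuous_onI measurable_ennreal])
  fix l u :: "(real^'n::_)^'k" assume le: "\<And>b. b \<in> Basis \<Longrightarrow> l \<bullet> b \<le> u \<bullet> b"
  have le': "l $ i \<bullet> b \<le> u $ i \<bullet> b" if "b \<in> Basis" for i b
    using le[of "axis i b"] that by (auto simp: Basis_vec_image[where 'a="real^'n::_"] inner_axis)
  have mem: "z \<in> box l u \<longleftrightarrow> (\<forall>t. z$t \<in> box (l$t) (u$t))" for z :: "(real^'n::_)^'k"
    by (force simp: mem_box Basis_vec_image[where 'a="real^'n::_"] inner_axis)
  have ind: "(\<Prod>t\<in>UNIV. ?J (z$t)) * indicator ((\<lambda>z. \<chi> t. v (z$t)) -` box l u) z =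
      (\<Prod>t\<in>UNIV. indicator (box (l$t) (u$t)) (v (z$t)) * ?J (z$t))" for z :: "(real^'n::_)^'k"
    by (auto simp: indicator_def mem prod_zero_iff intro!: prod.cong)
  have "emeasure (distr (density lborel (\<lambda>z. \<Prod>t\<in>UNIV. ?J (z$t))) borel (\<lambda>z. \<chi> t. v (z$t))) (box l u) =
      (\<integral>\<^sup>+z. (\<Prod>t\<in>UNIV. ?J (z$t)) * indicator ((\<lambda>z. \<chi> t. v (z$t)) -` box l u) z \<partial>lborel)"
    using measurable_sets[OF V, of "box l u"] by (simp add: emeasure_distr emeasure_density)
  also have "\<dots> = (\<Prod>t\<in>UNIV. \<integral>\<^sup>+x. indicator (box (l$t) (u$t)) (v x) * ?J x \<partial>lborel)"
    unfolding ind by (rule nn_integral_lborel_vec_prod) measurable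
  also have "\<dots> = (\<Prod>t\<in>UNIV. emeasure lborel (box (l$t) (u$t)))"
    by (simp add: nn_integral_diffeo[OF v])
  also have "\<dots> = (\<Prod>i\<in>UNIV. \<Prod>b\<in>Basis. (u $ i - l $ i) \<bullet> b)"
    by (subst prod_ennreal[symmetric])
       (auto intro!: prod_nonneg simp: le' inner_diff_left emeasure_lborel_box_eq)
  also have "\<dots> = (\<Prod>b\<in>Basis. (u - l) \<bullet> b)"
    by (simp add: prod_Basis_vec[where 'a="real^'n::_"] inner_axis)
  finally show "emeasure (distr (density lborel (\<lambda>z. \<Prod>t\<in>UNIV. ?J (z$t))) borel (\<lambda>z. \<chi> t. v (z$t))) (box l u) =
      (\<Prod>b\<in>Basis. (u - l) \<bullet> b)" .
qed simp

section \<open>From observational equivalence to equivalence up to diffeomorphism\<close>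

text \<open>Brings continuous and discrete actions to a common form with the actions fixed. For
  continuous actions the smooth extension also has the actions as arguments, and is composed with
  the affine embedding \<open>(x, z) \<mapsto> (x, z, a)\<close>.\<close>

lemma smooth_model_differentiable:
  fixes \<theta> :: "('dx::finite, 'dz::finite, 'da::finite, 'T::{finite,linorder}) latent_model"
  assumes "smooth_model A \<theta>" and a: "a \<in> action_seqs A"
  shows "(\<lambda>(x, z). dens \<theta> t i x z a) differentiable (at p)"
proof -
  consider (cont) "Ck_on 2 (UNIV \<times> UNIV \<times> action_seqs A) (\<lambda>(x, z, a). dens \<theta> t i x z a)"
    | (disc) "Ck_on 2 UNIV (\<lambda>(x, z). dens \<theta> t i x z a)"
    using assms unfolding smooth_model_def by blast
  then show ?thesis
  proof cases
    case cont
    then obtain U g where U: "open U" "UNIV \<times> UNIV \<times> action_seqs A \<subseteq> U" "Ck_open 2 U g"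
      and g: "\<forall>x\<in>UNIV \<times> UNIV \<times> action_seqs A. g x = (\<lambda>(x, z, a). dens \<theta> t i x z a) x"
      unfolding Ck_on_def by blast
    obtain x z where p: "p = (x, z)" by (cases p)
    have "(x, z, a) \<in> U" using U(2) a by auto
    then have "g differentiable (at (x, z, a))"
      using U(3) by (simp add: numeral_2_eq_2)
    moreover have "(\<lambda>(x, z). (x, z, a)) differentiable (at p)"
    proof -
      have "((\<lambda>q. (fst q, snd q, a)) has_derivative (\<lambda>h. (fst h, snd h, 0))) (at p)"
        by (auto intro!: derivative_eq_intros)
      then show ?thesis by (auto simp: differentiable_def split_def)
    qed
    ultimately have "(g \<circ> (\<lambda>(x, z). (x, z, a))) differentiable (at p)"
      unfolding p by (intro differentiable_chain_at) auto
    moreover have "g \<circ> (\<lambda>(x, z). (x, z, a)) = (\<lambda>(x, z). dens \<theta> t i x z a)"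
      using g a by auto
    ultimately show ?thesis by simp
  next
    case disc
    then obtain U g where "UNIV \<subseteq> U" "Ck_open 2 U g" "\<forall>x\<in>UNIV. g x = (\<lambda>(x, z). dens \<theta> t i x z a) x"
      unfolding Ck_on_def by blast
    then have "g = (\<lambda>(x, z). dens \<theta> t i x z a)" "g differentiable (at p)"
      by (auto simp: numeral_2_eq_2)
    then show ?thesis by simp
  qed
qed

lemma smooth_model_continuous:
  fixes \<theta> :: "('dx::finite, 'dz::finite, 'da::finite, 'T::{finite,linorder}) latent_model"
  assumes "smooth_model A \<theta>" and a: "a \<in> action_seqs A"
    and f: "continuous_on UNIV f" and g: "continuous_on UNIV g"
  shows "continuous_on UNIV (\<lambda>z. dens \<theta> t i (f z) (g z) a)"
proof -
  have "continuous_on UNIV (\<lambda>(x, z). dens \<theta> t i x z a)"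
    using smooth_model_differentiable[OF assms(1,2)] differentiable_imp_continuous_within
    by (intro continuous_at_imp_continuous_on) blast
  from continuous_on_compose2[OF this continuous_on_Pair[OF f g]] show ?thesis by simp
qed

text \<open>The set of agreement is closed and its complement is open and null, hence empty.\<close>

lemma continuous_eq_if_AE_eq:
  fixes f g :: "'a::euclidean_space \<Rightarrow> real"
  assumes "continuous_on UNIV f" "continuous_on UNIV g" "AE x in lborel. f x = g x"
  shows "f x = g x"
proof -
  have "closed {x. f x = g x}" using assms by (intro closed_Collect_eq)
  moreover have "AE x in lebesgue. x \<in> {x. f x = g x}"
    using assms(3) by (simp add: AE_completion)
  ultimately show ?thesis using mem_closed_if_AE_lebesgue by blast
qed

lemma continuous_on_columns:
  fixes v :: "'a::topological_space \<Rightarrow> 'b::topological_space"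
  assumes "continuous_on UNIV v"
  shows "continuous_on UNIV (\<lambda>z :: 'a^'k. \<chi> t. v (z$t))"
  by (intro continuous_on_vec_lambda continuous_on_compose2[OF assms]) (auto intro!: continuous_intros)

section \<open>The densities of one model for a fixed action sequence\<close>

context
  fixes A :: "(real^'da) set" and a :: "real^'da^'T::{finite,linorder}"
    and \<theta> :: "('dx::finite, 'dz::finite, 'da::finite, 'T::{finite,linorder}) latent_model"
  assumes gm: "graphical_model A \<theta>" and sm: "smooth_model A \<theta>" and a: "a \<in> action_seqs A"
begin

lemma dens_pos: "dens \<theta> t i x z a > 0"
  using gm a by (auto simp: graphical_model_def)

lemma dens_mass: "(\<integral>\<^sup>+x. ennreal (dens \<theta> t i x z a) \<partial>lborel) = 1"
  using gm a by (auto simp: graphical_model_def)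

lemma dens_graph:
  assumes "\<And>s j. s < t \<Longrightarrow> Gz \<theta> $ i $ j = 1 \<Longrightarrow> z$s$j = z'$s$j"
  shows "dens \<theta> t i x z a = dens \<theta> t i x z' a"
proof -
  have "\<forall>t i x z z'. \<forall>a\<in>action_seqs A. \<forall>a'\<in>action_seqs A.
      (\<forall>s<t. \<forall>j. Gz \<theta> $ i $ j = 1 \<longrightarrow> z$s$j = z'$s$j) \<longrightarrow>
      (\<forall>s\<le>t. \<forall>l. Ga \<theta> $ i $ l = 1 \<longrightarrow> a$s$l = a'$s$l) \<longrightarrow>
      dens \<theta> t i x z a = dens \<theta> t i x z' a'"
    using gm unfolding graphical_model_def by (elim conjE)
  then show ?thesis using a assms by auto
qed

lemma dens_history: "(\<And>s. s < t \<Longrightarrow> z$s = z'$s) \<Longrightarrow> dens \<theta> t i x z a = dens \<theta> t i x z' a"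
  by (rule dens_graph) simp

lemma measurable_dens: "(\<lambda>x. dens \<theta> t i x z a) \<in> borel_measurable borel"
  by (intro borel_measurable_continuous_onI smooth_model_continuous[OF sm a] continuous_intros)

lemma dens_prod_mass: "(\<integral>\<^sup>+w. ennreal (\<Prod>i\<in>UNIV. dens \<theta> t i (w$i) z a) \<partial>lborel) = 1"
proof -
  have "(\<integral>\<^sup>+w. ennreal (\<Prod>i\<in>UNIV. dens \<theta> t i (w$i) z a) \<partial>lborel) =
      (\<integral>\<^sup>+w. (\<Prod>i\<in>UNIV. ennreal (dens \<theta> t i (w$i) z a)) \<partial>lborel)"
    using dens_pos by (simp add: prod_ennreal less_imp_le)
  also have "\<dots> = 1"
    by (subst nn_integral_lborel_vec_prod) (simp_all add: dens_mass measurable_compose[OF measurable_dens measurable_ennreal])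
  finally show ?thesis .
qed

lemma continuous_on_joint_dens:
  "continuous_on UNIV (\<lambda>z. \<Prod>t\<in>UNIV. \<Prod>i\<in>UNIV. dens \<theta> t i (z$t$i) z a)"
  by (intro continuous_on_prod smooth_model_continuous[OF sm a] continuous_intros)

lemma joint_dens_pos: "(\<Prod>t\<in>UNIV. \<Prod>i\<in>UNIV. dens \<theta> t i (z$t$i) z a) > 0"
  using dens_pos by (intro prod_pos) auto

lemma prob_space_latent_law: "prob_space (latent_law \<theta> a)"
proof
  have "(\<integral>\<^sup>+z. (\<Prod>t\<in>UNIV. ennreal (\<Prod>i\<in>UNIV. dens \<theta> t i (z$t$i) z a)) \<partial>lborel) = 1"
  proof (rule chain_rule_total_mass[where q = "\<lambda>t w z. ennreal (\<Prod>i\<in>UNIV. dens \<theta> t i (w$i) z a)"])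
    fix t
    have "continuous_on UNIV (\<lambda>p. \<Prod>i\<in>UNIV. dens \<theta> t i (fst p$i) (snd p) a)"
      by (intro continuous_on_prod smooth_model_continuous[OF sm a] continuous_intros)
    then show "(\<lambda>(w, z). ennreal (\<Prod>i\<in>UNIV. dens \<theta> t i (w$i) z a)) \<in> borel_measurable borel"
      unfolding split_def by (intro measurable_compose[OF borel_measurable_continuous_onI measurable_ennreal])
  next
    fix t w and z z' :: "real^'dz^'T::_"
    assume "\<forall>s<t. z$s = z'$s"
    then have "dens \<theta> t i x z a = dens \<theta> t i x z' a" for i x
      by (intro dens_history) auto
    then show "ennreal (\<Prod>i\<in>UNIV. dens \<theta> t i (w$i) z a) = ennreal (\<Prod>i\<in>UNIV. dens \<theta> t i (w$i) z' a)"
      by simp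
  qed (rule dens_prod_mass)
  then have "(\<integral>\<^sup>+z. ennreal (\<Prod>t\<in>UNIV. \<Prod>i\<in>UNIV. dens \<theta> t i (z$t$i) z a) \<partial>lborel) = 1"
    using dens_pos by (simp add: prod_ennreal less_imp_le prod_nonneg)
  moreover have "(\<lambda>z. \<Prod>t\<in>UNIV. \<Prod>i\<in>UNIV. dens \<theta> t i (z$t$i) z a) \<in> borel_measurable borel"
    by (intro borel_measurable_continuous_onI continuous_on_joint_dens)
  ultimately show "emeasure (latent_law \<theta> a) (space (latent_law \<theta> a)) = 1"
    by (simp add: latent_law_def emeasure_density)
qed

text \<open>Full support of the latent law, from positivity of the joint density. This is what
  allows ranges to be read off from observed laws.\<close>

lemma latent_law_open_pos:
  assumes "open X" "X \<noteq> {}"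
  shows "emeasure (latent_law \<theta> a) X \<noteq> 0"
proof
  have m[measurable]: "(\<lambda>z. \<Prod>t\<in>UNIV. \<Prod>i\<in>UNIV. dens \<theta> t i (z$t$i) z a) \<in> borel_measurable borel"
    by (intro borel_measurable_continuous_onI continuous_on_joint_dens)
  have [measurable]: "X \<in> sets borel" using assms by simp
  assume "emeasure (latent_law \<theta> a) X = 0"
  then have "AE z in lborel. ennreal (\<Prod>t\<in>UNIV. \<Prod>i\<in>UNIV. dens \<theta> t i (z$t$i) z a) * indicator X z = 0"
    unfolding latent_law_def by (subst (asm) emeasure_density) (auto simp: nn_integral_0_iff_AE)
  then have "AE z in lborel. z \<notin> X"
    by (rule eventually_mono) (auto simp: indicator_def ennreal_eq_0_iff joint_dens_pos[unfolded not_le[symmetric]] split: if_splits)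
  then have "AE z in lebesgue. z \<in> X \<longrightarrow> z \<in> {}"
    by (simp add: AE_completion)
  then show False using mem_closed_if_AE_lebesgue_open[OF assms(1) closed_empty] assms(2) by auto
qed

end


section \<open>Comparison of the images and transport of the latent law\<close>

lemma range_mixing_subset:
  fixes \<theta> \<theta>' :: "('dx::finite, 'dz::finite, 'da::finite, 'T::{finite,linorder}) latent_model"
  assumes "graphical_model A \<theta>"
    and \<theta>': "graphical_model A \<theta>'" "smooth_model A \<theta>'" "a \<in> action_seqs A"
    and eq: "distr (latent_law \<theta> a) borel (\<lambda>z. \<chi> t. mixing \<theta> (z$t)) =
      distr (latent_law \<theta>' a) borel (\<lambda>z. \<chi> t. mixing \<theta>' (z$t))"
  shows "range (mixing \<theta>') \<subseteq> range (mixing \<theta>)"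
proof (rule ccontr)
  assume "\<not> range (mixing \<theta>') \<subseteq> range (mixing \<theta>)"
  then obtain w where w: "mixing \<theta>' w \<notin> range (mixing \<theta>)" by auto
  define F where "F f z = (\<chi> t. f (z$t))" for f :: "real^'dz \<Rightarrow> real^'dx" and z :: "(real^'dz)^'T::_"
  have cont: "continuous_on UNIV (F (mixing \<eta>))" if "graphical_model A \<eta>"
    for \<eta> :: "('dx, 'dz, 'da, 'T) latent_model"
    unfolding F_def using that
    by (intro continuous_on_columns Ck_on_1_continuous_on) (simp add: graphical_model_def diffeo_def)
  have meas: "F (mixing \<eta>) \<in> latent_law \<zeta> a \<rightarrow>\<^sub>M borel" if "graphical_model A \<eta>"
    for \<eta> \<zeta> :: "('dx, 'dz, 'da, 'T) latent_model"
    using borel_measurable_continuous_onI[OF cont[OF that]] by (simp add: latent_law_def)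
  have clos: "closed (range (mixing \<theta>))" using assms(1) by (simp add: graphical_model_def)
  \<comment> \<open>Trajectories with some column off the closed set \<open>range f\<close>. This
    open set is null for the law generated by \<open>f\<close>; if \<open>f'\<close> left that range
    at \<open>w\<close>, its preimage would be a neighbourhood of the constant trajectory
    \<open>w\<close> and so have positive mass.\<close>
  define Y where "Y = {y :: (real^'dx)^'T::_. \<exists>t. y$t \<in> - range (mixing \<theta>)}"
  have "open Y"
    unfolding Y_def Collect_ex_eq
    using clos by (intro open_UN ballI open_vimage[of "- range (mixing \<theta>)" "\<lambda>y. y $ t" for t, unfolded vimage_def] continuous_intros) auto
  then have sY: "Y \<in> sets borel" by simp
  have "F (mixing \<theta>) -` Y = {}" by (auto simp: F_def Y_def)
  then have "emeasure (latent_law \<theta>' a) (F (mixing \<theta>') -` Y) = 0"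
    using arg_cong[OF eq, of "\<lambda>M. emeasure M Y"] meas[OF assms(1), of \<theta>] meas[OF \<theta>'(1), of \<theta>'] sY
    unfolding F_def[symmetric, abs_def] by (simp add: emeasure_distr latent_law_def)
  moreover have "open (F (mixing \<theta>') -` Y)"
    by (intro open_vimage \<open>open Y\<close> cont \<theta>')
  moreover have "(\<chi> t. w) \<in> F (mixing \<theta>') -` Y"
    using w by (simp add: F_def Y_def)
  ultimately show False using latent_law_open_pos[OF \<theta>'] by blast
qed

lemma distr_latent_law_transition:
  fixes \<theta> \<theta>' :: "('dx::finite, 'dz::finite, 'da::finite, 'T::{finite,linorder}) latent_model"
  assumes gm: "graphical_model A \<theta>" "graphical_model A \<theta>'"
    and ran: "range (mixing \<theta>) = range (mixing \<theta>')"
    and eq: "distr (latent_law \<theta> a) borel (\<lambda>z. \<chi> t. mixing \<theta> (z$t)) =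
      distr (latent_law \<theta>' a) borel (\<lambda>z. \<chi> t. mixing \<theta>' (z$t))"
  shows "distr (latent_law \<theta>' a) borel (\<lambda>z. \<chi> t. transition \<theta> \<theta>' (z$t)) = latent_law \<theta> a"
proof -
  define F where "F f z = (\<chi> t. f (z$t))" for f :: "real^'dz \<Rightarrow> real^'dx" and z :: "(real^'dz)^'T::_"
  have cont: "continuous_on UNIV (F (mixing \<eta>))" if "graphical_model A \<eta>"
    for \<eta> :: "('dx, 'dz, 'da, 'T) latent_model"
    unfolding F_def using that
    by (intro continuous_on_columns Ck_on_1_continuous_on) (simp add: graphical_model_def diffeo_def)
  have meas: "F (mixing \<eta>) \<in> latent_law \<zeta> a \<rightarrow>\<^sub>M borel" if "graphical_model A \<eta>"
    for \<eta> \<zeta> :: "('dx, 'dz, 'da, 'T) latent_model"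
    using borel_measurable_continuous_onI[OF cont[OF that]] by (simp add: latent_law_def)
  have d: "diffeo UNIV (range (mixing \<theta>)) (mixing \<theta>)" "closed (range (mixing \<theta>))"
    using gm(1) by (simp_all add: graphical_model_def)
  then have inj: "inj (mixing \<theta>)" and C: "continuous_on (range (mixing \<theta>)) (inv (mixing \<theta>))"
    by (auto simp: diffeo_def bij_betw_def intro: Ck_on_1_continuous_on)
  \<comment> \<open>A total Borel left inverse of the mixing. The closed range makes the case
    distinction measurable, and the value 0 off the range is arbitrary. Applied columnwise, it turns
    the first observed law into the latent law and the second into its transport by the transition
    map.\<close>
  define g where "g y = (if y \<in> range (mixing \<theta>) then inv (mixing \<theta>) y else 0)" for y
  have [measurable]: "g \<in> borel_measurable borel"
    unfolding g_def using C d(2) by (intro borel_measurable_continuous_on_if) auto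
  have G: "(\<lambda>y :: (real^'dx)^'T::_. \<chi> t. g (y$t)) \<in> borel_measurable borel"
    by (intro measurable_vec_lambda) measurable
  have "distr (distr (latent_law \<theta> a) borel (F (mixing \<theta>))) borel (\<lambda>y. \<chi> t. g (y$t)) =
      distr (latent_law \<theta> a) borel (\<lambda>z. z)"
    using inj by (subst distr_distr[OF G meas[OF gm(1)]]) (simp add: F_def g_def comp_def)
  moreover have "distr (distr (latent_law \<theta>' a) borel (F (mixing \<theta>'))) borel (\<lambda>y. \<chi> t. g (y$t)) =
      distr (latent_law \<theta>' a) borel (\<lambda>z. \<chi> t. transition \<theta> \<theta>' (z$t))"
    using ran by (subst distr_distr[OF G meas[OF gm(2)]]) (simp add: F_def g_def comp_def transition_def)
  moreover have "distr (latent_law \<theta> a) borel (\<lambda>z. z) = latent_law \<theta> a"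
    by (rule distr_id2) (simp add: latent_law_def)
  ultimately show ?thesis
    using eq unfolding F_def[symmetric, abs_def] by simp
qed

text \<open>Both laws are written as images under the columnwise map \<open>V\<close>. Pushing back
  by its inverse \<open>W\<close> compares the densities before the transport; they agree almost
  everywhere, and everywhere by continuity.\<close>

lemma joint_dens_transition:
  fixes \<theta> \<theta>' :: "('dx::finite, 'dz::{finite,wellorder}, 'da::finite, 'T::{finite,linorder}) latent_model"
  assumes \<theta>: "graphical_model A \<theta>" "smooth_model A \<theta>" "a \<in> action_seqs A"
    and \<theta>': "graphical_model A \<theta>'" "smooth_model A \<theta>'" "a \<in> action_seqs A"
    and v: "diffeo UNIV UNIV v"
    and law: "distr (latent_law \<theta>' a) borel (\<lambda>z. \<chi> t. v (z$t)) = latent_law \<theta> a"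
  shows "(\<Prod>t\<in>UNIV. \<Prod>i\<in>UNIV. dens \<theta>' t i (z$t$i) z a) =
    (\<Prod>t\<in>UNIV. (\<Prod>i\<in>UNIV. dens \<theta> t i (v (z$t) $ i) (\<chi> r. v (z$r)) a) * \<bar>det (jacobian v (at (z$t)))\<bar>)"
proof -
  define V where "V z = (\<chi> t. v (z$t))" for z :: "(real^'dz::_)^'T::_"
  define W where "W z = (\<chi> t. inv v (z$t))" for z :: "(real^'dz::_)^'T::_"
  define p where "p z = (\<Prod>t\<in>UNIV. \<Prod>i\<in>UNIV. dens \<theta> t i (z$t$i) z a)" for z
  define p' where "p' z = (\<Prod>t\<in>UNIV. \<Prod>i\<in>UNIV. dens \<theta>' t i (z$t$i) z a)" for z
  define J where "J z = (\<Prod>t\<in>UNIV. \<bar>det (jacobian v (at (z$t)))\<bar>)" for z :: "(real^'dz::_)^'T::_"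
  have bij: "bij v" using v by (simp add: diffeo_def)
  have cV: "continuous_on UNIV V" and cW: "continuous_on UNIV W"
    unfolding V_def W_def using v
    by (simp_all only: diffeo_def continuous_on_columns Ck_on_1_continuous_on)
  have cp: "continuous_on UNIV p" and cp': "continuous_on UNIV p'"
    unfolding p_def p'_def by (rule continuous_on_joint_dens[OF \<theta>] continuous_on_joint_dens[OF \<theta>'])+
  have cJ: "continuous_on UNIV J"
  proof -
    have "continuous_on UNIV (\<lambda>z :: (real^'dz::_)^'T::_. \<bar>det (jacobian v (at (z$t)))\<bar>)" for t
      by (rule continuous_on_compose2[OF diffeo_UNIV_derivative(3)[OF v]]) (auto intro!: continuous_intros)
    then show ?thesis
      unfolding J_def by (intro continuous_on_prod)
  qed
  have cpV: "continuous_on UNIV (\<lambda>z. p (V z))"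
    using continuous_on_compose2[OF cp cV] by simp
  note [measurable] = cV[THEN borel_measurable_continuous_onI] cW[THEN borel_measurable_continuous_onI]
    cp[THEN borel_measurable_continuous_onI] cp'[THEN borel_measurable_continuous_onI]
    cJ[THEN borel_measurable_continuous_onI] cpV[THEN borel_measurable_continuous_onI]
  have nonneg: "p z \<ge> 0" "p' z \<ge> 0" "J z \<ge> 0" for z
    using joint_dens_pos[OF \<theta>] joint_dens_pos[OF \<theta>'] by (auto simp: p_def p'_def J_def prod_nonneg less_imp_le)
  have WV: "W (V z) = z" for z
    using bij by (simp add: W_def V_def bij_is_inj)
  have dJ: "distr (density lborel (\<lambda>z. ennreal (J z))) borel V = lborel"
    using distr_columnwise_diffeo_lborel[OF v, where 'k = 'T]
    by (simp add: J_def[abs_def] V_def[abs_def] prod_ennreal)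
  have "distr (density lborel (\<lambda>z. ennreal (p' z))) borel V = density lborel (\<lambda>z. ennreal (p z))"
    using law by (simp add: latent_law_def p_def[abs_def] p'_def[abs_def] V_def[abs_def])
  \<comment> \<open>Lebesgue measure is replaced by an image under \<open>V\<close>, so that the
    right-hand side becomes an image under \<open>V\<close> as well.\<close>
  also have "\<dots> = density (distr (density lborel (\<lambda>z. ennreal (J z))) borel V) (\<lambda>z. ennreal (p z))"
    by (simp only: dJ)
  also have "\<dots> = distr (density (density lborel (\<lambda>z. ennreal (J z))) (\<lambda>z. ennreal (p (V z)))) borel V"
    by (rule density_distr) measurable
  also have "density (density lborel (\<lambda>z. ennreal (J z))) (\<lambda>z. ennreal (p (V z))) =
      density lborel (\<lambda>z. ennreal (J z * p (V z)))"
    using nonneg by (subst density_density_eq) (auto simp: ennreal_mult)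
  finally have eq: "distr (density lborel (\<lambda>z. ennreal (p' z))) borel V =
      distr (density lborel (\<lambda>z. ennreal (J z * p (V z)))) borel V" .
  have undo: "distr (distr (density lborel f) borel V) borel W = density lborel f" for f
    by (subst distr_distr) (auto simp: comp_def WV intro!: distr_id2)
  have "density lborel (\<lambda>z. ennreal (p' z)) = density lborel (\<lambda>z. ennreal (J z * p (V z)))"
    using arg_cong[OF eq, of "\<lambda>M. distr M borel W"] unfolding undo .
  then have "AE z in lborel. ennreal (p' z) = ennreal (J z * p (V z))"
    by (intro sigma_finite_measure.density_unique[OF sigma_finite_lborel]) auto
  then have "AE z in lborel. p' z = J z * p (V z)"
    using nonneg by simp
  then have "p' z = J z * p (V z)"
    by (intro continuous_eq_if_AE_eq cp' continuous_on_mult cJ cpV)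
  then show ?thesis
    by (simp add: p'_def p_def J_def V_def prod.distrib mult.commute)
qed

lemma diff_equiv_if_obs_equiv:
  fixes \<theta> \<theta>' :: "('dx::finite, 'dz::{finite,wellorder}, 'da::finite, 'T::{finite,linorder}) latent_model"
  assumes "A \<noteq> {}" "\<sigma>2 \<ge> 0"
    and \<theta>: "graphical_model A \<theta>" "smooth_model A \<theta>"
    and \<theta>': "graphical_model A \<theta>'" "smooth_model A \<theta>'"
    and obs: "obs_equiv A \<sigma>2 \<theta> \<theta>'"
  shows "diff_equiv A \<theta> \<theta>'" and "diffeo UNIV UNIV (transition \<theta> \<theta>')"
proof -
  have d: "diffeo UNIV (range (mixing \<theta>)) (mixing \<theta>)" "diffeo UNIV (range (mixing \<theta>')) (mixing \<theta>')"
    using \<theta>(1) \<theta>'(1) by (simp_all add: graphical_model_def)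
  then have cont: "continuous_on UNIV (mixing \<theta>)" "continuous_on UNIV (mixing \<theta>')"
    by (simp_all add: diffeo_def Ck_on_1_continuous_on)
  have eq: "distr (latent_law \<theta> a) borel (\<lambda>z. \<chi> t. mixing \<theta> (z$t)) =
      distr (latent_law \<theta>' a) borel (\<lambda>z. \<chi> t. mixing \<theta>' (z$t))" if a: "a \<in> action_seqs A" for a
    using obs a by (intro obs_law_eqD[OF assms(2) _ _ _ cont] prob_space_latent_law[OF \<theta> a] prob_space_latent_law[OF \<theta>' a])
      (simp add: obs_equiv_def)
  \<comment> \<open>One constant action sequence suffices for the ranges, because the mixing
    functions do not depend on the actions.\<close>
  obtain x where "x \<in> A" using assms(1) by auto
  then have a0: "(\<chi> t. x) \<in> action_seqs A" by (simp add: action_seqs_def)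
  have ran: "range (mixing \<theta>) = range (mixing \<theta>')"
    using range_mixing_subset[OF \<theta>(1) \<theta>' a0 eq[OF a0]] range_mixing_subset[OF \<theta>'(1) \<theta> a0 eq[OF a0, symmetric]]
    by auto
  define v where "v = transition \<theta> \<theta>'"
  show v: "diffeo UNIV UNIV (transition \<theta> \<theta>')"
    by (rule diffeo_transition[OF d ran])
  then have v': "diffeo UNIV UNIV v" by (simp add: v_def)
  have cont_v: "continuous_on UNIV v" using v' by (auto simp: diffeo_def intro: Ck_on_1_continuous_on)
  have cond: "(\<Prod>i\<in>UNIV. dens \<theta>' t i (z$t$i) z a) =
      (\<Prod>i\<in>UNIV. dens \<theta> t i (v (z$t) $ i) (\<chi> r. v (z$r)) a) * \<bar>det (jacobian v (at (z$t)))\<bar>"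
    if a: "a \<in> action_seqs A" for t z a
  \<comment> \<open>\<open>r\<close> consists of the conditional densities of
    \<open>\<theta>\<close> transported by \<open>v\<close>: again positive, dependent on the past
    alone, and of mass 1 by change of variables. Equality of the joint densities therefore separates
    into equality at each time.\<close>
  proof (rule chain_rule_unique[where q = "\<lambda>t w z. \<Prod>i\<in>UNIV. dens \<theta>' t i (w$i) z a" and
        r = "\<lambda>t w z. (\<Prod>i\<in>UNIV. dens \<theta> t i (v w $ i) (\<chi> r. v (z$r)) a) * \<bar>det (jacobian v (at w))\<bar>"])
    note Jc = diffeo_UNIV_derivative(3)[OF v']
    show "(\<lambda>w. \<Prod>i\<in>UNIV. dens \<theta>' t i (w$i) z a) \<in> borel_measurable borel" for t z
      by (intro borel_measurable_continuous_onI continuous_on_prod smooth_model_continuous[OF \<theta>'(2) a] continuous_intros)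
    show "(\<lambda>w. (\<Prod>i\<in>UNIV. dens \<theta> t i (v w $ i) (\<chi> r. v (z$r)) a) * \<bar>det (jacobian v (at w))\<bar>) \<in> borel_measurable borel" for t z
      by (intro borel_measurable_continuous_onI continuous_on_mult Jc continuous_on_prod
          smooth_model_continuous[OF \<theta>(2) a] continuous_intros cont_v)
    show "(\<Prod>i\<in>UNIV. dens \<theta>' t i (w$i) z a) > 0" for t w z
      using dens_pos[OF \<theta>' a] by (intro prod_pos) auto
    show "(\<Prod>i\<in>UNIV. dens \<theta> t i (v w $ i) (\<chi> r. v (z$r)) a) * \<bar>det (jacobian v (at w))\<bar> > 0" for t w z
      using dens_pos[OF \<theta> a] diffeo_UNIV_derivative(2)[OF v', of w]
      by (intro mult_pos_pos prod_pos) (auto simp: invertible_det_nz)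
    show "(\<Prod>i\<in>UNIV. dens \<theta>' t i (w$i) z a) = (\<Prod>i\<in>UNIV. dens \<theta>' t i (w$i) z' a)"
      if "\<forall>s<t. z$s = z'$s" for t w z z'
      using that by (intro prod.cong refl dens_history[OF \<theta>' a]) auto
    show "(\<Prod>i\<in>UNIV. dens \<theta> t i (v w $ i) (\<chi> r. v (z$r)) a) * \<bar>det (jacobian v (at w))\<bar> =
        (\<Prod>i\<in>UNIV. dens \<theta> t i (v w $ i) (\<chi> r. v (z'$r)) a) * \<bar>det (jacobian v (at w))\<bar>"
      if "\<forall>s<t. z$s = z'$s" for t w z z'
      using that by (intro arg_cong2[where f = "(*)"] prod.cong refl dens_history[OF \<theta> a]) auto
    show "(\<integral>\<^sup>+w. ennreal (\<Prod>i\<in>UNIV. dens \<theta>' t i (w$i) z a) \<partial>lborel) = 1" for t z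
      by (rule dens_prod_mass[OF \<theta>' a])
    show "(\<integral>\<^sup>+w. ennreal ((\<Prod>i\<in>UNIV. dens \<theta> t i (v w $ i) (\<chi> r. v (z$r)) a) * \<bar>det (jacobian v (at w))\<bar>) \<partial>lborel) = 1" for t z
    proof -
      let ?g = "\<lambda>w. ennreal (\<Prod>i\<in>UNIV. dens \<theta> t i (w $ i) (\<chi> r. v (z$r)) a)"
      have "(\<lambda>w. \<Prod>i\<in>UNIV. dens \<theta> t i (w $ i) (\<chi> r. v (z$r)) a) \<in> borel_measurable borel"
        by (intro borel_measurable_continuous_onI continuous_on_prod smooth_model_continuous[OF \<theta>(2) a] continuous_intros)
      then have "(\<integral>\<^sup>+w. ?g (v w) * ennreal \<bar>det (jacobian v (at w))\<bar> \<partial>lborel) = (\<integral>\<^sup>+w. ?g w \<partial>lborel)"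
        by (intro nn_integral_diffeo[OF v'] measurable_compose[OF _ measurable_ennreal])
      then show ?thesis
        using dens_prod_mass[OF \<theta> a] dens_pos[OF \<theta> a] by (simp add: ennreal_mult prod_nonneg less_imp_le)
    qed
    show "(\<Prod>t\<in>UNIV. \<Prod>i\<in>UNIV. dens \<theta>' t i (z$t$i) z a) =
        (\<Prod>t\<in>UNIV. (\<Prod>i\<in>UNIV. dens \<theta> t i (v (z$t) $ i) (\<chi> r. v (z$r)) a) * \<bar>det (jacobian v (at (z$t)))\<bar>)" for z
      using distr_latent_law_transition[OF \<theta>(1) \<theta>'(1) ran eq[OF a]]
      by (intro joint_dens_transition[OF \<theta> a \<theta>' a v']) (simp add: v_def)
  qed
  show "diff_equiv A \<theta> \<theta>'"
    unfolding diff_equiv_def Let_def using ran cond by (simp add: v_def)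
qed

section \<open>Sparsity patterns and permutations\<close>

text \<open>For the matrix unit \<open>E\<close> at \<open>(i, j)\<close>, the entry of
  \<open>L^T E L\<close> at \<open>(k, l)\<close> is \<open>L$i$k * L$j$l\<close>. Used once along a
  transversal, to embed the graph, and once for arbitrary \<open>k\<close> and \<open>l\<close>, to
  show preservation.\<close>

lemma mat_space_conj_entry:
  fixes L G G' :: "real^'n^'n"
  assumes L: "\<And>M. M \<in> mat_space G \<Longrightarrow> transpose L ** M ** L \<in> mat_space G'"
    and "G$i$j \<noteq> 0" "L$i$k \<noteq> 0" "L$j$l \<noteq> 0"
  shows "G'$k$l \<noteq> 0"
proof
  assume G': "G'$k$l = 0"
  define E :: "real^'n^'n" where "E = (\<chi> p q. if p = i \<and> q = j then 1 else 0)"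
  have "E \<in> mat_space G" using assms(2) by (auto simp: E_def mat_space_def)
  then have "(transpose L ** E ** L)$k$l = 0" using L G' by (auto simp: mat_space_def)
  moreover have "(transpose L ** E)$k$q = (if q = j then L$i$k else 0)" for q
    unfolding matrix_matrix_mult_def transpose_def E_def
    by (simp add: if_distrib[of "\<lambda>x. _ * x"] sum.delta cong: if_cong)
  then have "(transpose L ** E ** L)$k$l = L$i$k * L$j$l"
    unfolding matrix_matrix_mult_def[of "transpose L ** E"]
    by (simp add: if_distrib[of "\<lambda>x. x * _"] sum.delta cong: if_cong)
  ultimately show False using assms by simp
qed

text \<open>A nonzero determinant has a nonzero summand in its Leibniz expansion, and all factors of
  that summand are nonzero.\<close>

lemma invertible_nonzero_transversal:
  fixes L :: "real^'n^'n"
  assumes "invertible L"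
  obtains \<sigma> where "bij \<sigma>" "\<And>i. L$i$\<sigma> i \<noteq> 0"
proof -
  have "det L \<noteq> 0" using assms by (simp add: invertible_det_nz)
  then obtain p where p: "p permutes UNIV" "of_int (sign p) * (\<Prod>i\<in>UNIV. L$i$p i) \<noteq> 0"
    unfolding det_def by (metis (no_types, lifting) mem_Collect_eq sum.neutral)
  then show ?thesis using that[of p] permutes_bij by auto
qed

text \<open>Orientation: the \<open>j\<close>-th unit vector goes to the
  \<open>\<sigma> j\<close>-th. Conjugation thus moves the entry \<open>(i, j)\<close> to
  \<open>(\<sigma> i, \<sigma> j)\<close>, while right multiplication brings column
  \<open>\<sigma> j\<close> to place \<open>j\<close> and so puts the transversal of
  \<open>L\<close> on the diagonal.\<close>

definition perm_mat :: "('n \<Rightarrow> 'n) \<Rightarrow> real^'n^'n" where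
  "perm_mat \<sigma> = (\<chi> i j. if i = \<sigma> j then 1 else 0)"

lemma permutation_mat_perm_mat: "bij \<sigma> \<Longrightarrow> permutation_mat (perm_mat \<sigma>)"
  by (auto simp: permutation_mat_def perm_mat_def)

lemma transpose_perm_mat_vec: "(transpose (perm_mat \<sigma>) *v x)$j = x$\<sigma> j"
  by (simp add: perm_mat_def matrix_vector_mult_def transpose_def if_distrib[of "\<lambda>x. x * _"] sum.delta cong: if_cong)

lemma perm_mat_vec: "bij \<sigma> \<Longrightarrow> (perm_mat \<sigma> *v x)$\<sigma> j = x$j"
  by (simp add: perm_mat_def matrix_vector_mult_def bij_is_inj inj_eq if_distrib[of "\<lambda>x. x * _"] sum.delta cong: if_cong)

lemma mult_perm_mat: "(L ** perm_mat \<sigma>)$i$j = L$i$\<sigma> j"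
  by (simp add: perm_mat_def matrix_matrix_mult_def if_distrib[of "\<lambda>x. _ * x"] sum.delta cong: if_cong)

lemma perm_mat_mult_transpose:
  assumes "bij \<sigma>"
  shows "perm_mat \<sigma> ** transpose (perm_mat \<sigma>) = mat 1" "transpose (perm_mat \<sigma>) ** perm_mat \<sigma> = mat 1"
proof -
  have "transpose (perm_mat \<sigma>) *v (perm_mat \<sigma> *v x) = x" for x :: "real^'a"
    by (simp only: vec_eq_iff transpose_perm_mat_vec perm_mat_vec[OF assms] simp_thms)
  then show "transpose (perm_mat \<sigma>) ** perm_mat \<sigma> = mat 1"
    by (simp only: matrix_eq matrix_vector_mul_assoc[symmetric] matrix_vector_mul_lid simp_thms)
  then show "perm_mat \<sigma> ** transpose (perm_mat \<sigma>) = mat 1"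
    by (simp add: matrix_left_right_inverse)
qed

lemma perm_mat_conj:
  assumes "bij \<sigma>"
  shows "(perm_mat \<sigma> ** G ** transpose (perm_mat \<sigma>))$\<sigma> i$\<sigma> j = G$i$j"
proof -
  have "(perm_mat \<sigma> ** G)$\<sigma> i$k = G$i$k" for k
    using assms by (simp add: perm_mat_def matrix_matrix_mult_def bij_is_inj inj_eq if_distrib[of "\<lambda>x. x * _"] sum.delta cong: if_cong)
  then show ?thesis
    using assms unfolding matrix_matrix_mult_def[of "perm_mat \<sigma> ** G"]
    by (simp add: perm_mat_def transpose_def bij_is_inj inj_eq if_distrib[of "\<lambda>x. _ * x"] sum.delta cong: if_cong)
qed

lemma perm_mat_conj_subset:
  assumes "bij \<sigma>" and "\<And>i j. G$i$j \<noteq> 0 \<Longrightarrow> G'$\<sigma> i$\<sigma> j \<noteq> 0"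
  shows "perm_mat \<sigma> ** G ** transpose (perm_mat \<sigma>) \<subseteq>\<^sub>m G'"
  unfolding mat_le_def
proof (intro allI impI)
  fix k l assume *: "(perm_mat \<sigma> ** G ** transpose (perm_mat \<sigma>))$k$l \<noteq> 0"
  obtain i j where "k = \<sigma> i" "l = \<sigma> j" using assms(1) by (metis bij_pointE)
  then show "G'$k$l \<noteq> 0" using * assms by (simp add: perm_mat_conj)
qed

text \<open>\<open>\<sigma> \<times> \<sigma>\<close> maps the support of \<open>G\<close>
  injectively into that of \<open>G'\<close>, which is no larger; the image is therefore the whole
  support. For binary matrices the support determines the entries.\<close>

lemma perm_mat_conj_eq_if_sparse:
  fixes G G' :: "real^'n^'n"
  assumes \<sigma>: "bij \<sigma>" and sub: "\<And>i j. G$i$j \<noteq> 0 \<Longrightarrow> G'$\<sigma> i$\<sigma> j \<noteq> 0"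
    and bin: "binary_mat G" "binary_mat G'" and sparse: "norm0 G' \<le> norm0 G"
  shows "G'$\<sigma> i$\<sigma> j = G$i$j" and "G' = perm_mat \<sigma> ** G ** transpose (perm_mat \<sigma>)"
proof -
  let ?S = "\<lambda>G :: real^'n^'n. {(i, j). G$i$j \<noteq> 0}"
  have inj: "inj (map_prod \<sigma> \<sigma>)" using \<sigma> by (simp add: bij_is_inj prod.inj_map)
  have "map_prod \<sigma> \<sigma> ` ?S G \<subseteq> ?S G'" using sub by auto
  moreover have "card (map_prod \<sigma> \<sigma> ` ?S G) = card (?S G)"
    by (rule card_image) (rule inj_on_subset[OF inj subset_UNIV])
  ultimately have eq: "map_prod \<sigma> \<sigma> ` ?S G = ?S G'"
    using sparse by (intro card_seteq) (auto simp: norm0_def)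
  have *: "G'$\<sigma> i$\<sigma> j = G$i$j" for i j
  proof -
    have "G'$\<sigma> i$\<sigma> j \<noteq> 0 \<longleftrightarrow> map_prod \<sigma> \<sigma> (i, j) \<in> map_prod \<sigma> \<sigma> ` ?S G"
      unfolding eq by simp
    also have "\<dots> \<longleftrightarrow> (i, j) \<in> ?S G"
      by (rule inj_image_mem_iff[OF inj])
    also have "\<dots> \<longleftrightarrow> G$i$j \<noteq> 0" by simp
    finally show ?thesis
      using bin unfolding binary_mat_def by (metis empty_iff insert_iff)
  qed
  show "G'$\<sigma> i$\<sigma> j = G$i$j" by (rule *)
  show "G' = perm_mat \<sigma> ** G ** transpose (perm_mat \<sigma>)"
    unfolding vec_eq_iff
  proof (intro allI)
    fix k l
    obtain i j where "k = \<sigma> i" "l = \<sigma> j" using \<sigma> by (metis bij_pointE)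
    then show "G'$k$l = (perm_mat \<sigma> ** G ** transpose (perm_mat \<sigma>))$k$l"
      using \<sigma> by (simp add: * perm_mat_conj)
  qed
qed

lemma preserving_matI:
  assumes "\<And>i j k. B$i$j \<noteq> 0 \<Longrightarrow> C$i$k \<noteq> 0 \<Longrightarrow> B$k$j \<noteq> 0"
  shows "preserving_mat B C"
  unfolding preserving_mat_def
proof (rule image_subsetI)
  fix M assume M: "M \<in> mat_space B"
  show "transpose C ** M \<in> mat_space B"
    unfolding mat_space_def
  proof (intro CollectI allI impI)
    fix k j assume "B$k$j = 0"
    then have "C$i$k * M$i$j = 0" for i
      using assms[of i j k] M by (auto simp: mat_space_def)
    then have "(\<Sum>i\<in>UNIV. C$i$k * M$i$j) = 0" by (intro sum.neutral) blast
    then show "(transpose C ** M)$k$j = 0"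
      by (simp add: matrix_matrix_mult_def transpose_def)
  qed
qed

text \<open>Taking \<open>l = j\<close> in the two-sided condition gives preservation of
  \<open>G\<close>, and \<open>k = i\<close> gives that of its transpose; the diagonal supplies the
  other nonzero factor. Allowing a sparser \<open>H\<close> covers both \<open>C\<close> itself and
  a dependency graph bounded by its pattern.\<close>

lemma preserving_mat_conj_transversal:
  fixes C G :: "real^'n^'n"
  assumes C: "\<And>i j k l. G$i$j \<noteq> 0 \<Longrightarrow> C$i$k \<noteq> 0 \<Longrightarrow> C$j$l \<noteq> 0 \<Longrightarrow> G$k$l \<noteq> 0"
    and diag: "\<And>i. C$i$i \<noteq> 0" and H: "\<And>i j. H$i$j \<noteq> 0 \<Longrightarrow> C$i$j \<noteq> 0"
  shows "preserving_mat G H" and "preserving_mat (transpose G) H"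
proof -
  show "preserving_mat G H" by (rule preserving_matI) (use C[OF _ H diag] in blast)
  show "preserving_mat (transpose G) H"
    by (rule preserving_matI) (use C[OF _ diag H] in \<open>auto simp: transpose_def\<close>)
qed

section \<open>Jacobians\<close>

lemma jacobian_entry_zero:
  fixes f :: "real^'n \<Rightarrow> real^'m"
  assumes f: "f differentiable (at x)" and const: "\<And>h. f (x + h *\<^sub>R axis j 1) $ i = f x $ i"
  shows "jacobian f (at x) $ i $ j = 0"
proof -
  have D: "(f has_derivative (\<lambda>h. jacobian f (at x) *v h)) (at x)"
    using f jacobian_works by blast
  have 1: "((\<lambda>h :: real. x + h *\<^sub>R axis j 1) has_derivative (\<lambda>h. h *\<^sub>R axis j 1)) (at 0)"
    by (auto intro!: derivative_eq_intros)
  have "((\<lambda>h. f (x + h *\<^sub>R axis j 1)) has_derivative (\<lambda>h. jacobian f (at x) *v (h *\<^sub>R axis j 1))) (at 0)"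
    using has_derivative_compose[OF 1, of f "\<lambda>h. jacobian f (at x) *v h"] D by simp
  then have "((\<lambda>h. f (x + h *\<^sub>R axis j 1) $ i) has_derivative (\<lambda>h. (jacobian f (at x) *v (h *\<^sub>R axis j 1)) $ i)) (at 0)"
    by (rule bounded_linear.has_derivative[OF bounded_linear_vec_nth])
  then have "((\<lambda>h :: real. f x $ i) has_derivative (\<lambda>h. (jacobian f (at x) *v (h *\<^sub>R axis j 1)) $ i)) (at 0)"
    by (simp only: const)
  then have "(\<lambda>h :: real. (jacobian f (at x) *v (h *\<^sub>R axis j 1)) $ i) = (\<lambda>h. 0)"
    using has_derivative_const has_derivative_unique by blast
  from fun_cong[OF this, of 1] show ?thesis
    by (simp add: matrix_vector_mult_def axis_def if_distrib[of "\<lambda>x. _ * x"] sum.delta cong: if_cong)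
qed

lemma matrix_inv_inverse:
  assumes "invertible A"
  shows "A ** matrix_inv A = mat 1" "matrix_inv A ** A = mat 1"
  using someI_ex[OF assms[unfolded invertible_def]] by (simp_all add: matrix_inv_def)

lemma matrix_inv_diagonal:
  fixes D :: "real^'n^'n"
  assumes inv: "invertible D" and diag: "\<And>i j. i \<noteq> j \<Longrightarrow> D$i$j = 0" and "i \<noteq> j"
  shows "matrix_inv D $ i $ j = 0"
proof -
  have "D$i$i * matrix_inv D$i$k = (if i = k then 1 else 0)" for k
  proof -
    have "(\<Sum>l\<in>UNIV. D$i$l * matrix_inv D$l$k) = (\<Sum>l\<in>{i}. D$i$l * matrix_inv D$l$k)"
      by (rule sum.mono_neutral_right) (use diag in auto)
    then have "D$i$i * matrix_inv D$i$k = (D ** matrix_inv D)$i$k"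
      by (simp add: matrix_matrix_mult_def)
    also have "\<dots> = (if i = k then 1 else 0)"
      by (simp add: matrix_inv_inverse(1)[OF inv] mat_def)
    finally show ?thesis .
  qed
  \<comment> \<open>The first instance shows that the \<open>i\<close>-th diagonal entry of
    \<open>D\<close> is nonzero, so it cancels in the second.\<close>
  from this[of i] this[of j] show ?thesis using \<open>i \<noteq> j\<close> by auto
qed

section \<open>Quasi-linear equivalence\<close>

lemma log_dens_eq:
  assumes "exponential_family A h s lam \<theta>" "a \<in> action_seqs A"
  shows "ln (dens \<theta> t i x z a) =
    ln (h i x) + s i x * lam t z a $ i - log_normalizer (h i) (s i) (lam t z a $ i)"
    and "dens \<theta> t i x z a > 0"
proof -
  have "dens \<theta> t i x z a = h i x * exp (s i x * lam t z a $ i - log_normalizer (h i) (s i) (lam t z a $ i))"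
    and "h i x > 0"
    using assms by (auto simp: exponential_family_def)
  then show "ln (dens \<theta> t i x z a) =
      ln (h i x) + s i x * lam t z a $ i - log_normalizer (h i) (s i) (lam t z a $ i)"
    "dens \<theta> t i x z a > 0"
    by (simp_all add: ln_mult)
qed

text \<open>The difference of log-densities at two points eliminates the normalizer. This expresses
  \<open>lam\<close> through the densities, from which it inherits differentiability and the graph
  condition.\<close>

lemma natural_parameter_eq:
  assumes "exponential_family A h s lam \<theta>" "a \<in> action_seqs A" and "s i x \<noteq> s i x'"
  shows "lam t z a $ i =
    (ln (dens \<theta> t i x z a) - ln (dens \<theta> t i x' z a) - (ln (h i x) - ln (h i x'))) / (s i x - s i x')"
  using assms(3) by (simp add: log_dens_eq(1)[OF assms(1,2)] field_simps)

lemma natural_parameter_history: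
  assumes "exponential_family A h s lam \<theta>" "a \<in> action_seqs A" "\<And>r. r < t \<Longrightarrow> z$r = z'$r"
  shows "lam t z a = lam t z' a"
proof -
  have "\<forall>t z z'. \<forall>a\<in>action_seqs A. \<forall>a'\<in>action_seqs A.
      (\<forall>r<t. z$r = z'$r) \<longrightarrow> (\<forall>r\<le>t. a$r = a'$r) \<longrightarrow> lam t z a = lam t z' a'"
    using assms(1) unfolding exponential_family_def by (elim conjE)
  then show ?thesis using assms(2,3) by blast
qed

lemma ln_dens_prod:
  fixes \<theta> :: "('dx::finite, 'dz::finite, 'da::finite, 'T::{finite,linorder}) latent_model"
  assumes "exponential_family A h s lam \<theta>" "a \<in> action_seqs A"
  shows "ln (\<Prod>i\<in>UNIV. dens \<theta> t i (w$i) z a) = (\<Sum>i\<in>UNIV. ln (h i (w$i))) +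
    apply_coords s w \<bullet> lam t z a - (\<Sum>i\<in>UNIV. log_normalizer (h i) (s i) (lam t z a $ i))"
proof -
  have "ln (\<Prod>i\<in>UNIV. dens \<theta> t i (w$i) z a) = (\<Sum>i\<in>UNIV. ln (dens \<theta> t i (w$i) z a))"
    by (intro ln_prod) (simp_all add: log_dens_eq(2)[OF assms] less_imp_neq[OF log_dens_eq(2)[OF assms], symmetric])
  then show ?thesis
    by (simp add: log_dens_eq(1)[OF assms] sum.distrib sum_subtractf apply_coords_def inner_vec_def)
qed

lemma diff_equiv_log_identity:
  fixes \<theta> \<theta>' :: "('dx::finite, 'dz::finite, 'da::finite, 'T::{finite,linorder}) latent_model"
  assumes ef: "exponential_family A h s lam \<theta>" "exponential_family A h s lam' \<theta>'"
    and equiv: "diff_equiv A \<theta> \<theta>'" and v: "diffeo UNIV UNIV (transition \<theta> \<theta>')"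
  shows "\<exists>K N. \<forall>t z w. \<forall>a\<in>action_seqs A.
    apply_coords s w \<bullet> lam' t z a =
    apply_coords s (transition \<theta> \<theta>' w) \<bullet> lam t (\<chi> r. transition \<theta> \<theta>' (z$r)) a + K w + N t z a"
proof -
  define v where "v = transition \<theta> \<theta>'"
  define K where "K w = (\<Sum>i\<in>UNIV. ln (h i (v w $ i))) + ln \<bar>det (jacobian v (at w))\<bar> -
    (\<Sum>i\<in>UNIV. ln (h i (w$i)))" for w
  define \<psi> where "\<psi> l = (\<Sum>i\<in>UNIV. log_normalizer (h i) (s i) (l $ i))" for l :: "real^'dz"
  define N where "N t z a = \<psi> (lam' t z a) - \<psi> (lam t (\<chi> r. v (z$r)) a)" for t z a
  have "apply_coords s w \<bullet> lam' t z a = apply_coords s (v w) \<bullet> lam t (\<chi> r. v (z$r)) a + K w + N t z a"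
    if a: "a \<in> action_seqs A" for t z w a
  proof -
    \<comment> \<open>\<open>diff_equiv\<close> reads the current latent and its history off one
      trajectory. Overwriting column \<open>t\<close> makes the current value \<open>w\<close>
      independent of \<open>z\<close>, and leaves both parameters unchanged since they only see
      earlier columns.\<close>
    define y where "y = (\<chi> r. if r = t then w else z$r)"
    have yt: "y$t = w" by (simp add: y_def)
    have lam_y: "lam' t y a = lam' t z a" "lam t (\<chi> r. v (y$r)) a = lam t (\<chi> r. v (z$r)) a"
      by (auto simp: y_def intro!: natural_parameter_history[OF ef(2) a] natural_parameter_history[OF ef(1) a])
    have "(\<Prod>i\<in>UNIV. dens \<theta>' t i (w$i) y a) =
        (\<Prod>i\<in>UNIV. dens \<theta> t i (v w $ i) (\<chi> r. v (y$r)) a) * \<bar>det (jacobian v (at w))\<bar>"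
      using equiv a unfolding diff_equiv_def Let_def v_def yt[symmetric] by auto
    moreover have "(\<Prod>i\<in>UNIV. dens \<theta> t i (v w $ i) (\<chi> r. v (y$r)) a) > 0"
      using log_dens_eq(2)[OF ef(1) a] by (intro prod_pos) auto
    moreover have "\<bar>det (jacobian v (at w))\<bar> > 0"
      using diffeo_UNIV_derivative(2)[OF v] by (simp add: v_def invertible_det_nz)
    ultimately have "ln (\<Prod>i\<in>UNIV. dens \<theta>' t i (w$i) y a) =
        ln (\<Prod>i\<in>UNIV. dens \<theta> t i (v w $ i) (\<chi> r. v (y$r)) a) + ln \<bar>det (jacobian v (at w))\<bar>"
      by (simp only: ln_mult_pos)
    then show ?thesis
      unfolding ln_dens_prod[OF ef(1) a] ln_dens_prod[OF ef(2) a] lam_y K_def N_def \<psi>_def by simp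
  qed
  then show ?thesis unfolding v_def by blast
qed

text \<open>If \<open>y$i\<close> were nonzero, moving coordinate \<open>i\<close> alone between two
  points with different values of \<open>s i\<close> would change the inner product. This is how
  minimality of the statistics enters the linear algebra.\<close>

lemma affine_nondegenerate:
  fixes s :: "'n::finite \<Rightarrow> real \<Rightarrow> real"
  assumes "\<And>i. \<not> s i constant_on UNIV" and const: "\<And>w. apply_coords s w \<bullet> y = c"
  shows "y = 0"
proof (rule ccontr)
  assume "y \<noteq> 0"
  then obtain i where i: "y$i \<noteq> 0" by (auto simp: vec_eq_iff)
  obtain x x' where x: "s i x \<noteq> s i x'"
    using assms(1)[of i] unfolding constant_on_def by blast
  define w where "w x = (\<chi> j. if j = i then x else 0)" for x :: real
  have "apply_coords s (w x) - apply_coords s (w x') = axis i (s i x - s i x')"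
    by (simp add: vec_eq_iff apply_coords_def w_def axis_def)
  moreover have "(apply_coords s (w x) - apply_coords s (w x')) \<bullet> y = 0"
    by (simp add: inner_diff_left const)
  ultimately show False using i x by (simp add: inner_axis')
qed

lemma span_sufficient_variability:
  assumes "sufficient_variability A lam"
  shows "\<exists>(t :: nat \<Rightarrow> 'T::{finite,linorder}) z a. (\<forall>r\<le>CARD('dz). a r \<in> action_seqs A) \<and>
    span ((\<lambda>r. lam (t r) (z r) (a r) - lam (t 0) (z 0) (a 0) :: real^'dz) ` {1..CARD('dz)}) = UNIV"
proof -
  obtain t :: "nat \<Rightarrow> 'T" and z a where a: "\<forall>r\<in>{0..CARD('dz)}. a r \<in> action_seqs A"
    and w: "inj_on (\<lambda>r. lam (t r) (z r) (a r) - lam (t 0) (z 0) (a 0)) {1..CARD('dz)}"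
      "independent ((\<lambda>r. lam (t r) (z r) (a r) - lam (t 0) (z 0) (a 0) :: real^'dz) ` {1..CARD('dz)})"
    using assms unfolding sufficient_variability_def Let_def by blast
  have "UNIV \<subseteq> span ((\<lambda>r. lam (t r) (z r) (a r) - lam (t 0) (z 0) (a 0) :: real^'dz) ` {1..CARD('dz)})"
  proof (rule card_ge_dim_independent[OF _ w(2)])
    show "dim (UNIV :: (real^'dz) set) \<le>
        card ((\<lambda>r. lam (t r) (z r) (a r) - lam (t 0) (z 0) (a 0) :: real^'dz) ` {1..CARD('dz)})"
      unfolding card_image[OF w(1)] by simp
  qed simp
  then show ?thesis using a by (intro exI[of _ t] exI[of _ z] exI[of _ a]) auto
qed

text \<open>Subtracting the identity at two histories removes \<open>K\<close>, so pairing
  \<open>s(v w)\<close> with a difference of values of \<open>lam\<close> is affine in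
  \<open>s(w)\<close>. Such differences span the space, and the property is linear in the vector
  paired with, which gives \<open>L\<close> and \<open>b\<close>. Inserting this back and
  subtracting two histories again yields the relation for \<open>lam'\<close>.\<close>

lemma quasi_linear_transition:
  fixes \<theta> \<theta>' :: "('dx::finite, 'dz::finite, 'da::finite, 'T::{finite,linorder}) latent_model"
    and A :: "(real^'da) set"
  assumes nonconst: "\<And>i. \<not> s i constant_on UNIV"
    and var: "sufficient_variability A lam"
    and surj: "surj v"
    and id: "\<And>t z w a. a \<in> action_seqs A \<Longrightarrow>
      apply_coords s w \<bullet> lam' t z a = apply_coords s (v w) \<bullet> lam t (\<chi> r. v (z$r)) a + K w + N t z a"
  shows "\<exists>(L :: real^'dz^'dz) b c. invertible L \<and> (\<forall>w. apply_coords s (v w) = L *v apply_coords s w + b) \<and>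
    (\<forall>t (z :: (real^'dz)^'T::_). \<forall>a\<in>action_seqs A. lam' t z a = transpose L *v lam t (\<chi> r. v (z$r)) a + c)"
proof -
  obtain t :: "nat \<Rightarrow> 'T" and z and a :: "nat \<Rightarrow> real^'da^'T::_" where
    "\<forall>r\<le>CARD('dz). a r \<in> action_seqs A"
    and sp: "span ((\<lambda>r. lam (t r) (z r) (a r) - lam (t 0) (z 0) (a 0) :: real^'dz) ` {1..CARD('dz)}) = UNIV"
    using span_sufficient_variability[OF var] by blast
  then have a: "a r \<in> action_seqs A" if "r \<le> CARD('dz)" for r using that by blast
  \<comment> \<open>The identity evaluates \<open>lam\<close> at the image of the history under
    \<open>v\<close>; the preimages make it hit the given points \<open>z r\<close>.\<close>
  define y where "y r = (\<chi> k. inv v (z r $ k))" for r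
  have vy: "(\<chi> k. v (y r $ k)) = z r" for r
    using surj by (simp add: y_def surj_f_inv_f vec_eq_iff)
  define P where "P x \<longleftrightarrow> (\<exists>x' d. \<forall>w. apply_coords s (v w) \<bullet> x = apply_coords s w \<bullet> x' + d)" for x
  have "P x" if "x \<in> span ((\<lambda>r. lam (t r) (z r) (a r) - lam (t 0) (z 0) (a 0)) ` {1..CARD('dz)})" for x
    using that
  proof (induction rule: span_induct_alt)
    case base
    show ?case unfolding P_def by (intro exI[of _ 0]) simp
  next
    case (step k x u)
    then obtain r where r: "r \<le> CARD('dz)" "x = lam (t r) (z r) (a r) - lam (t 0) (z 0) (a 0)" by auto
    obtain u' d where u: "\<And>w. apply_coords s (v w) \<bullet> u = apply_coords s w \<bullet> u' + d"
      using step unfolding P_def by blast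
    define x' where "x' = lam' (t r) (y r) (a r) - lam' (t 0) (y 0) (a 0)"
    define e where "e = N (t 0) (y 0) (a 0) - N (t r) (y r) (a r)"
    have x: "apply_coords s (v w) \<bullet> x = apply_coords s w \<bullet> x' + e" for w
      using id[OF a[OF r(1)], of w "t r" "y r"] id[OF a[of 0], of w "t 0" "y 0"] r(2)
      by (simp add: vy inner_diff_right x'_def e_def)
    have "apply_coords s (v w) \<bullet> (k *\<^sub>R x + u) = apply_coords s w \<bullet> (k *\<^sub>R x' + u') + (k * e + d)" for w
      by (simp add: inner_add_right u x distrib_left)
    then show ?case unfolding P_def by blast
  qed
  then have "P x" for x by (simp only: sp UNIV_I)
  then obtain l d where ld: "\<And>x w. apply_coords s (v w) \<bullet> x = apply_coords s w \<bullet> l x + d x"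
    unfolding P_def by metis
  \<comment> \<open>The chosen functions \<open>l\<close> and \<open>d\<close> are not known to be
    linear. Only their values at unit vectors enter, as rows of \<open>L\<close> and entries of
    \<open>b\<close>.\<close>
  define L where "L = (\<chi> i. l (axis i 1))"
  define b where "b = (\<chi> i. d (axis i 1))"
  have sv: "apply_coords s (v w) = L *v apply_coords s w + b" for w
  proof (subst vec_eq_iff, intro allI)
    fix i
    have "apply_coords s (v w) $ i = apply_coords s (v w) \<bullet> axis i 1" by (simp add: inner_axis)
    also have "\<dots> = (L *v apply_coords s w + b) $ i"
      unfolding ld by (simp add: L_def b_def matrix_vector_mul_component inner_commute)
    finally show "apply_coords s (v w) $ i = (L *v apply_coords s w + b) $ i" .
  qed
  have sv_inner: "apply_coords s (v w) \<bullet> x = apply_coords s w \<bullet> (transpose L *v x) + b \<bullet> x" for w x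
    by (simp add: sv inner_add_left dot_lmul_matrix[symmetric] inner_commute[of "L *v _"] inner_commute[of "x v* L"])
  \<comment> \<open>For \<open>x\<close> in the kernel, \<open>s(v w) \<bullet> x\<close> does not
    depend on \<open>w\<close>. As \<open>v\<close> is onto, \<open>s(w) \<bullet> x\<close> is
    constant, so minimality gives \<open>x = 0\<close>.\<close>
  have "x = 0" if "transpose L *v x = 0" for x
  proof (rule affine_nondegenerate[OF nonconst])
    fix w
    obtain w' where "w = v w'" using surj by (metis surjD)
    then show "apply_coords s w \<bullet> x = b \<bullet> x" using sv_inner[of w' x] that by simp
  qed
  then have "invertible (transpose L)"
    by (simp add: invertible_left_inverse matrix_left_invertible_ker)
  then have L: "invertible L" by (simp add: invertible_det_nz)
  have lam': "lam' t' z' a' = transpose L *v lam t' (\<chi> r. v (z'$r)) a' + (lam' (t 0) (y 0) (a 0) - transpose L *v lam (t 0) (z 0) (a 0))"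
    if a': "a' \<in> action_seqs A" for t' z' a'
  proof -
    \<comment> \<open>The offset \<open>c\<close> is read off at the base point 0. In the difference
      from that point \<open>K\<close> cancels, so the pairing of \<open>?x\<close> with
      \<open>s(w)\<close> does not depend on \<open>w\<close>.\<close>
    let ?x = "lam' t' z' a' - transpose L *v lam t' (\<chi> r. v (z'$r)) a' -
      (lam' (t 0) (y 0) (a 0) - transpose L *v lam (t 0) (z 0) (a 0))"
    have "apply_coords s w \<bullet> ?x = b \<bullet> lam t' (\<chi> r. v (z'$r)) a' - b \<bullet> lam (t 0) (z 0) (a 0) +
        N t' z' a' - N (t 0) (y 0) (a 0)" for w
      using id[OF a', of w t' z'] id[OF a[of 0], of w "t 0" "y 0"]
      unfolding vy sv_inner inner_diff_right by simp
    then have "?x = 0" by (rule affine_nondegenerate[OF nonconst])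
    then show ?thesis by (simp add: algebra_simps)
  qed
  show ?thesis using L sv lam' by blast
qed

section \<open>The dependency structure under equivalence\<close>

lemma has_derivative_vec_lambda:
  fixes f :: "'a::real_normed_vector \<Rightarrow> 'b::euclidean_space^'n"
  assumes "\<And>i. ((\<lambda>x. f x $ i) has_derivative (\<lambda>k. f' k $ i)) (at x)"
  shows "(f has_derivative f') (at x)"
  using assms by (subst has_derivative_componentwise_within)
    (auto simp: Basis_vec_image inner_axis intro!: has_derivative_inner_left)

text \<open>Each component of \<open>lam\<close> is a quotient built from logarithms of positive
  differentiable densities, by evaluating at two points that \<open>s i\<close> separates.\<close>

lemma differentiable_natural_parameter:
  fixes \<theta> :: "('dx::finite, 'dz::finite, 'da::finite, 'T::{finite,linorder}) latent_model"
  assumes sm: "smooth_model A \<theta>" and ef: "exponential_family A h s lam \<theta>" and a: "a \<in> action_seqs A"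
    and nonconst: "\<And>i. \<not> s i constant_on UNIV"
  shows "(\<lambda>w. lam t (\<chi> r. if r = u then w else z$r) a) differentiable (at w)"
proof -
  define H where "H w = (\<chi> r. if r = u then w else z$r)" for w
  have H: "(H has_derivative (\<lambda>k. \<chi> r. if r = u then k else 0)) (at w)" for w
    unfolding H_def
  proof (rule has_derivative_vec_lambda)
    show "((\<lambda>w. (\<chi> r. if r = u then w else z$r) $ r) has_derivative
        (\<lambda>k. (\<chi> r. if r = u then k else 0) $ r)) (at w)" for r
      by (cases "r = u") (auto intro!: derivative_eq_intros)
  qed
  have "(\<lambda>w. lam t (H w) a $ i) differentiable (at w)" for i
  proof -
    obtain x x' where x: "s i x \<noteq> s i x'"
      using nonconst[of i] unfolding constant_on_def by blast
    have D: "(\<lambda>w. dens \<theta> t i y (H w) a) differentiable (at w)" for y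
    proof -
      have "((\<lambda>w. (y, H w)) has_derivative (\<lambda>k. (0, \<chi> r. if r = u then k else 0))) (at w)"
        by (intro has_derivative_Pair has_derivative_const H)
      then have "(\<lambda>w. (y, H w)) differentiable (at w)" by (auto simp: differentiable_def)
      then have "((\<lambda>(x, z). dens \<theta> t i x z a) \<circ> (\<lambda>w. (y, H w))) differentiable (at w)"
        by (rule differentiable_chain_at) (rule smooth_model_differentiable[OF sm a])
      then show ?thesis by (simp add: comp_def)
    qed
    have ln: "(\<lambda>w. ln (dens \<theta> t i y (H w) a)) differentiable (at w)" for y
    proof -
      obtain D' where "((\<lambda>w. dens \<theta> t i y (H w) a) has_derivative D') (at w)"
        using D unfolding differentiable_def by blast
      from has_derivative_ln[OF log_dens_eq(2)[OF ef a] this] show ?thesis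
        by (auto simp: differentiable_def)
    qed
    show ?thesis
      unfolding natural_parameter_eq[where lam = lam, OF ef a x]
      by (intro differentiable_divide differentiable_diff ln) (use x in auto)
  qed
  then have "((\<lambda>w. lam t (H w) a) has_derivative (\<lambda>k. \<chi> i. frechet_derivative (\<lambda>w. lam t (H w) a $ i) (at w) k)) (at w)"
    by (intro has_derivative_vec_lambda) (simp add: frechet_derivative_works[symmetric])
  then show ?thesis by (auto simp: differentiable_def H_def)
qed

text \<open>If \<open>Gz\<close> vanishes at \<open>(i, j)\<close>, moving latent coordinate
  \<open>j\<close> in the past leaves all densities of coordinate \<open>i\<close> unchanged, hence
  also the parameter recovered from them.\<close>

lemma column_jacobian_graph:
  fixes \<theta> :: "('dx::finite, 'dz::finite, 'da::finite, 'T::{finite,linorder}) latent_model"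
  assumes gm: "graphical_model A \<theta>" and sm: "smooth_model A \<theta>" and ef: "exponential_family A h s lam \<theta>"
    and a: "a \<in> action_seqs A" and nonconst: "\<And>i. \<not> s i constant_on UNIV"
  shows "column_jacobian lam u t z a \<in> mat_space (Gz \<theta>)"
  unfolding mat_space_def column_jacobian_def
proof (intro CollectI allI impI jacobian_entry_zero differentiable_natural_parameter[OF sm ef a nonconst])
  fix i j and k :: real
  assume G: "Gz \<theta> $ i $ j = 0"
  obtain x x' where x: "s i x \<noteq> s i x'"
    using nonconst[of i] unfolding constant_on_def by blast
  have "dens \<theta> t i y (\<chi> r. if r = u then z$u + k *\<^sub>R axis j 1 else z$r) a =
      dens \<theta> t i y (\<chi> r. if r = u then z$u else z$r) a" for y
    by (rule dens_graph[OF gm sm a]) (use G in \<open>auto simp: axis_def\<close>)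
  then show "lam t (\<chi> r. if r = u then z$u + k *\<^sub>R axis j 1 else z$r) a $ i =
      lam t (\<chi> r. if r = u then z$u else z$r) a $ i"
    unfolding natural_parameter_eq[where lam = lam, OF ef a x] by simp
qed

lemma mat_space_mult_diagonal:
  fixes M D :: "real^'n^'n"
  assumes "M \<in> mat_space G" and "\<And>i j. i \<noteq> j \<Longrightarrow> D$i$j = 0"
  shows "M ** D \<in> mat_space G"
  unfolding mat_space_def
proof (intro CollectI allI impI)
  fix i j assume "G$i$j = 0"
  then have "M$i$k * D$k$j = 0" for k
    using assms by (cases "k = j") (auto simp: mat_space_def)
  then have "(\<Sum>k\<in>UNIV. M$i$k * D$k$j) = 0" by (intro sum.neutral) blast
  then show "(M ** D)$i$j = 0" by (simp add: matrix_matrix_mult_def)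
qed

text \<open>Differentiating \<open>S \<circ> v = L S + b\<close> gives
  \<open>Dv DS^-1 = DS(v)^-1 L\<close>. The chain rule for \<open>lam'\<close> ends in
  \<open>Dv\<close>, so multiplying by \<open>DS^-1\<close> leaves a conjugation by the constant
  matrix \<open>L\<close>.\<close>

lemma column_jacobian_transition:
  fixes v :: "real^'dz \<Rightarrow> real^'dz::finite" and z :: "(real^'dz)^'T::{finite,linorder}" and S :: "real^'dz \<Rightarrow> real^'dz"
  assumes v: "v differentiable (at (z$u))"
    and S: "\<And>x. S differentiable (at x)" "\<And>x. invertible (jacobian S (at x))"
    and lam: "\<And>w. (\<lambda>w. lam t (\<chi> r. if r = u then w else v (z$r)) a) differentiable (at w)"
    and sv: "\<And>w. S (v w) = L *v S w + b"
    and lam': "\<And>z. lam' t z a = transpose L *v lam t (\<chi> r. v (z$r)) a + c"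
  shows "column_jacobian lam' u t z a ** matrix_inv (jacobian S (at (z$u))) =
    transpose L ** (column_jacobian lam u t (\<chi> r. v (z$r)) a ** matrix_inv (jacobian S (at (v (z$u))))) ** L"
proof -
  let ?x = "z$u"
  let ?Dv = "jacobian v (at ?x)" and ?S = "jacobian S (at ?x)" and ?Sv = "jacobian S (at (v ?x))"
  define \<phi> where "\<phi> w = lam t (\<chi> r. if r = u then w else v (z$r)) a" for w
  have mv: "((\<lambda>x. M *v x + d) has_derivative (\<lambda>x. M *v x)) (at y)" for M :: "real^'dz^'dz" and d y
    by (auto intro!: derivative_eq_intros bounded_linear_imp_has_derivative)
  have Dv: "(v has_derivative (\<lambda>k. ?Dv *v k)) (at ?x)"
    using v jacobian_works by blast
  have DS: "(S has_derivative (\<lambda>k. jacobian S (at y) *v k)) (at y)" for y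
    using S(1) jacobian_works by blast
  have D\<phi>: "(\<phi> has_derivative (\<lambda>k. jacobian \<phi> (at (v ?x)) *v k)) (at (v ?x))"
    using lam jacobian_works unfolding \<phi>_def by blast
  have "(\<lambda>w. L *v S w + b) = (\<lambda>w. S (v w))" by (simp add: sv)
  then have "(\<lambda>k. L *v (?S *v k)) = (\<lambda>k. ?Sv *v (?Dv *v k))"
    using has_derivative_compose[OF DS mv[of L b]] has_derivative_compose[OF Dv DS] has_derivative_unique
    by (metis (no_types, lifting))
  then have "L ** ?S = ?Sv ** ?Dv"
    unfolding matrix_eq matrix_vector_mul_assoc[symmetric] by metis
  then have "matrix_inv ?Sv ** (L ** ?S) ** matrix_inv ?S = matrix_inv ?Sv ** (?Sv ** ?Dv) ** matrix_inv ?S"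
    by simp
  then have Dv_eq: "?Dv ** matrix_inv ?S = matrix_inv ?Sv ** L"
    using matrix_inv_inverse[OF S(2)[of ?x]] matrix_inv_inverse[OF S(2)[of "v ?x"]]
    by (metis matrix_mul_assoc matrix_mul_lid matrix_mul_rid)
  have fun_eq: "(\<lambda>w. lam' t (\<chi> r. if r = u then w else z$r) a) = (\<lambda>w. transpose L *v \<phi> (v w) + c)"
  proof
    fix w
    have "(\<chi> r. v ((\<chi> r. if r = u then w else z$r) $ r)) = (\<chi> r. if r = u then v w else v (z$r))"
      by (simp add: vec_eq_iff)
    then show "lam' t (\<chi> r. if r = u then w else z$r) a = transpose L *v \<phi> (v w) + c"
      by (simp add: lam' \<phi>_def)
  qed
  have "((\<lambda>w. transpose L *v \<phi> (v w) + c) has_derivative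
      (\<lambda>k. transpose L *v (jacobian \<phi> (at (v ?x)) *v (?Dv *v k)))) (at ?x)"
    by (rule has_derivative_compose[OF has_derivative_compose[OF Dv D\<phi>] mv])
  then have "((\<lambda>w. transpose L *v \<phi> (v w) + c) has_derivative
      (\<lambda>k. (transpose L ** jacobian \<phi> (at (v ?x)) ** ?Dv) *v k)) (at ?x)"
    by (simp only: matrix_vector_mul_assoc matrix_mul_assoc)
  from frechet_derivative_at[OF this]
  have "column_jacobian lam' u t z a = transpose L ** jacobian \<phi> (at (v ?x)) ** ?Dv"
    unfolding column_jacobian_def jacobian_def fun_eq by (metis matrix_of_matrix_vector_mul)
  moreover have "column_jacobian lam u t (\<chi> r. v (z$r)) a = jacobian \<phi> (at (v ?x))"
    by (simp add: column_jacobian_def \<phi>_def[abs_def] cong: if_cong)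
  ultimately show ?thesis
    using Dv_eq by (simp only: matrix_mul_assoc[symmetric])
qed

lemma jacobian_apply_coords_diagonal:
  assumes "apply_coords s differentiable (at x)" "i \<noteq> j"
  shows "jacobian (apply_coords s) (at x) $ i $ j = 0"
  using assms by (intro jacobian_entry_zero) (auto simp: apply_coords_def axis_def)

text \<open>The claim is linear in \<open>M\<close>, so the spanning Jacobians of the influence
  condition suffice. Conjugated by \<open>L\<close> they become Jacobians of \<open>lam'\<close>,
  which respect the graph of \<open>\<theta>'\<close>.\<close>

lemma mat_space_transition:
  fixes \<theta> \<theta>' :: "('dx::finite, 'dz::finite, 'da::finite, 'T::{finite,linorder}) latent_model"
    and A :: "(real^'da) set" and v :: "real^'dz \<Rightarrow> real^'dz"
  assumes \<theta>: "smooth_model A \<theta>" "exponential_family A h s lam \<theta>"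
    and \<theta>': "graphical_model A \<theta>'" "smooth_model A \<theta>'" "exponential_family A h s lam' \<theta>'"
    and nonconst: "\<And>i. \<not> s i constant_on UNIV"
    and infl: "sufficient_influence_z A s lam G"
    and S: "\<And>x. apply_coords s differentiable (at x)" "\<And>x. v differentiable (at x)" "surj v"
    and sv: "\<And>w. apply_coords s (v w) = L *v apply_coords s w + b"
    and lam': "\<And>t z a. a \<in> action_seqs A \<Longrightarrow> lam' t z a = transpose L *v lam t (\<chi> r. v (z$r)) a + c"
    and M: "M \<in> mat_space G"
  shows "transpose L ** M ** L \<in> mat_space (Gz \<theta>')"
proof -
  have inv: "\<And>x. invertible (jacobian (apply_coords s) (at x))"
    using infl unfolding sufficient_influence_z_def by blast
  obtain t u :: "nat \<Rightarrow> 'T" and z and a :: "nat \<Rightarrow> real^'da^'T::_" where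
    a: "\<forall>r\<in>{1..norm0 G}. a r \<in> action_seqs A \<and> u r < t r" and
    sp: "span ((\<lambda>r. column_jacobian lam (u r) (t r) (z r) (a r) **
        matrix_inv (jacobian (apply_coords s) (at (z r $ u r)))) ` {1..norm0 G}) = mat_space G"
    using infl unfolding sufficient_influence_z_def by blast
  define P where "P M \<longleftrightarrow> transpose L ** M ** L \<in> mat_space (Gz \<theta>')" for M
  have entry: "(transpose L ** M ** L)$i$j = (\<Sum>l\<in>UNIV. (\<Sum>k\<in>UNIV. L$k$i * M$k$l) * L$l$j)" for M i j
    by (simp add: matrix_matrix_mult_def transpose_def)
  have sub: "P 0" "P M \<Longrightarrow> P N \<Longrightarrow> P (k *\<^sub>R M + N)" for M N k
  proof -
    have *: "(transpose L ** (k *\<^sub>R M + N) ** L)$i$j =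
        k * (transpose L ** M ** L)$i$j + (transpose L ** N ** L)$i$j" for i j
      unfolding entry by (simp add: algebra_simps sum.distrib sum_distrib_left sum_distrib_right)
    show "P 0" by (simp add: P_def mat_space_def entry)
    show "P M \<Longrightarrow> P N \<Longrightarrow> P (k *\<^sub>R M + N)" by (simp add: P_def mat_space_def *)
  qed
  have gen: "P (column_jacobian lam (u r) (t r) (z r) (a r) **
      matrix_inv (jacobian (apply_coords s) (at (z r $ u r))))" if "r \<in> {1..norm0 G}" for r
  proof -
    have ar: "a r \<in> action_seqs A" using a that by blast
    \<comment> \<open>The spanning points belong to \<open>\<theta>\<close>; the corresponding
      history of \<open>\<theta>'\<close> is their preimage under \<open>v\<close>.\<close>
    define y where "y = (\<chi> k. inv v (z r $ k))"
    have vy: "(\<chi> k. v (y $ k)) = z r" and vyu: "v (y $ u r) = z r $ u r"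
      using S(3) by (simp_all add: y_def surj_f_inv_f vec_eq_iff)
    have "transpose L ** (column_jacobian lam (u r) (t r) (\<chi> k. v (y $ k)) (a r) **
        matrix_inv (jacobian (apply_coords s) (at (v (y $ u r))))) ** L =
        column_jacobian lam' (u r) (t r) y (a r) ** matrix_inv (jacobian (apply_coords s) (at (y $ u r)))"
    proof (rule column_jacobian_transition[symmetric])
      show "(\<lambda>w. lam (t r) (\<chi> ra. if ra = u r then w else v (y $ ra)) (a r)) differentiable (at w)" for w
        using differentiable_natural_parameter[OF \<theta> ar nonconst, of "t r" "u r" "\<chi> k. v (y $ k)" w] by (simp cong: if_cong)
    qed (use S inv sv lam'[OF ar] in auto)
    moreover have "column_jacobian lam' (u r) (t r) y (a r) **
        matrix_inv (jacobian (apply_coords s) (at (y $ u r))) \<in> mat_space (Gz \<theta>')"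
      \<comment> \<open>\<open>s\<close> acts coordinatewise, so \<open>Ds^-1\<close> is diagonal
        and only rescales columns, which preserves the support.\<close>
      by (intro mat_space_mult_diagonal column_jacobian_graph[OF \<theta>' ar nonconst] matrix_inv_diagonal inv
          jacobian_apply_coords_diagonal S)
    ultimately show ?thesis by (simp only: P_def vy vyu)
  qed
  have "M \<in> span ((\<lambda>r. column_jacobian lam (u r) (t r) (z r) (a r) **
        matrix_inv (jacobian (apply_coords s) (at (z r $ u r)))) ` {1..norm0 G})"
    using M sp by simp
  then have "P M"
    by (induction rule: span_induct_alt) (use sub gen in auto)
  then show ?thesis by (simp add: P_def)
qed

text \<open>Coordinate \<open>i\<close> of \<open>c z\<close> enters through the injective
  \<open>s i\<close>, and its statistic is the sum of
  \<open>L$i$\<sigma> j * s (\<sigma> j) (z$j)\<close> plus a constant. A zero coefficient at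
  \<open>k\<close> thus excludes dependence on \<open>z$k\<close>. The permutation acts inside
  \<open>s\<close>, hence the index \<open>\<sigma> j\<close> of the statistic.\<close>

lemma dependency_graph_quasi_linear:
  fixes c :: "real^'n \<Rightarrow> real^'n"
  assumes inj: "inj (apply_coords s)" and bij: "bij \<sigma>"
    and c: "\<And>z. apply_coords s (c z) = L *v apply_coords s (perm_mat \<sigma> *v z) + b"
    and "dependency_graph c $ i $ k \<noteq> 0"
  shows "(L ** perm_mat \<sigma>)$i$k \<noteq> 0"
proof
  assume zero: "(L ** perm_mat \<sigma>)$i$k = 0"
  obtain x y where xy: "\<And>j. j \<noteq> k \<Longrightarrow> x$j = y$j" and ne: "c x $ i \<noteq> c y $ i"
    using assms(4) by (auto simp: dependency_graph_def split: if_splits)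
  have si: "inj (s i)"
  proof (rule injI)
    fix p q assume "s i p = s i q"
    then have "apply_coords s (\<chi> j. if j = i then p else 0) = apply_coords s (\<chi> j. if j = i then q else 0)"
      by (simp add: apply_coords_def vec_eq_iff)
    from injD[OF inj this] show "p = q" by (auto simp: vec_eq_iff split: if_splits)
  qed
  have "s i (c z $ i) = (\<Sum>j\<in>UNIV. L$i$\<sigma> j * s (\<sigma> j) (z$j)) + b$i" for z
  proof -
    have "s i (c z $ i) = apply_coords s (c z) $ i" by (simp add: apply_coords_def)
    also have "\<dots> = (\<Sum>m\<in>UNIV. L$i$m * s m ((perm_mat \<sigma> *v z)$m)) + b$i"
      unfolding c by (simp add: matrix_vector_mult_def[of L] apply_coords_def)
    also have "(\<Sum>m\<in>UNIV. L$i$m * s m ((perm_mat \<sigma> *v z)$m)) =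
        (\<Sum>j\<in>UNIV. L$i$\<sigma> j * s (\<sigma> j) ((perm_mat \<sigma> *v z)$\<sigma> j))"
      by (rule sum.reindex_bij_betw[OF bij, symmetric])
    finally show ?thesis by (simp add: perm_mat_vec[OF bij])
  qed
  moreover have "(\<Sum>j\<in>UNIV. L$i$\<sigma> j * s (\<sigma> j) (x$j)) = (\<Sum>j\<in>UNIV. L$i$\<sigma> j * s (\<sigma> j) (y$j))"
  proof (rule sum.cong[OF refl])
    show "L$i$\<sigma> j * s (\<sigma> j) (x$j) = L$i$\<sigma> j * s (\<sigma> j) (y$j)" for j
      using zero xy by (cases "j = k") (auto simp: mult_perm_mat)
  qed
  ultimately have "s i (c x $ i) = s i (c y $ i)" by simp
  with si ne show False by (simp add: inj_eq)
qed

theorem theorem5: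
  fixes A :: "(real^'da) set"
    and \<sigma>2 :: real
    and h s :: "'dz::{finite,wellorder} \<Rightarrow> real \<Rightarrow> real"
    and \<theta> \<theta>' :: "('dx::finite, 'dz, 'da::finite, 'T::{finite,linorder}) latent_model"
    and lam lam' :: "'T \<Rightarrow> (real^'dz::_)^'T::_ \<Rightarrow> real^'da^'T::_ \<Rightarrow> real^'dz::_"
  assumes "CARD('dz) \<le> CARD('dx)" and "\<sigma>2 \<ge> 0" and "A \<noteq> {}"
    and "graphical_model A \<theta>" and "smooth_model A \<theta>" and "exponential_family A h s lam \<theta>"
    and "graphical_model A \<theta>'" and "smooth_model A \<theta>'" and "exponential_family A h s lam' \<theta>'"
    and "obs_equiv A \<sigma>2 \<theta> \<theta>'"
    and "\<And>i. \<not> s i constant_on UNIV"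
    and "sufficient_variability A lam"
    and "diffeo UNIV (range (apply_coords s)) (apply_coords s)"
    and "sufficient_influence_z A s lam (Gz \<theta>)"
  shows "(\<exists>P. permutation_mat P \<and> P ** Gz \<theta> ** transpose P \<subseteq>\<^sub>m Gz \<theta>') \<and>
    (norm0 (Gz \<theta>') \<le> norm0 (Gz \<theta>) \<longrightarrow>
       z_consistent A \<theta> \<theta>' \<and> lin_equiv A s \<theta> \<theta>' \<and>
       (\<exists>P b C. permutation_mat P \<and> invertible C \<and>
          preserving_mat (Gz \<theta>) C \<and> preserving_mat (transpose (Gz \<theta>)) C \<and>
          (\<forall>z. C *v (transpose P *v apply_coords s z) + b \<in> range (apply_coords s) \<and>
               transition \<theta> \<theta>' z =
                 inv (apply_coords s) (C *v (transpose P *v apply_coords s z) + b))))"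
proof -
  define v where "v = transition \<theta> \<theta>'"
  let ?S = "apply_coords s"
  note diff = diff_equiv_if_obs_equiv[OF assms(3,2,4,5,7,8,10)]
  have v: "diffeo UNIV UNIV v" using diff(2) by (simp add: v_def)
  then have surj: "surj v" by (simp add: diffeo_def bij_def)
  have inj_S: "inj ?S" using assms(13) by (simp add: diffeo_def bij_betw_def)
  have diff_S: "?S differentiable (at x)" for x
    using assms(13) by (intro Ck_on_1_UNIV_D) (simp add: diffeo_def)
  have diff_v: "v differentiable (at x)" for x
    using v by (intro Ck_on_1_UNIV_D) (simp add: diffeo_def)
  have bin: "binary_mat (Gz \<theta>)" "binary_mat (Gz \<theta>')"
    using assms(4,7) by (simp_all add: graphical_model_def)
  obtain K N where "\<forall>t z w. \<forall>a\<in>action_seqs A.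
      ?S w \<bullet> lam' t z a = ?S (v w) \<bullet> lam t (\<chi> r. v (z$r)) a + K w + N t z a"
    using diff_equiv_log_identity[OF assms(6,9) diff] unfolding v_def by blast
  then have id: "?S w \<bullet> lam' t z a = ?S (v w) \<bullet> lam t (\<chi> r. v (z$r)) a + K w + N t z a"
    if "a \<in> action_seqs A" for t z w a using that by blast
  have "\<exists>L b c. invertible L \<and> (\<forall>w. ?S (v w) = L *v ?S w + b) \<and>
      (\<forall>t z. \<forall>a\<in>action_seqs A. lam' t z a = transpose L *v lam t (\<chi> r. v (z$r)) a + c)"
    by (rule quasi_linear_transition[OF assms(11,12) surj id])
  then obtain L b c where L: "invertible L" and "\<forall>w. ?S (v w) = L *v ?S w + b"
    and "\<forall>t z. \<forall>a\<in>action_seqs A. lam' t z a = transpose L *v lam t (\<chi> r. v (z$r)) a + c"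
    by blast
  then have sv: "?S (v w) = L *v ?S w + b"
    and lam': "a \<in> action_seqs A \<Longrightarrow> lam' t z a = transpose L *v lam t (\<chi> r. v (z$r)) a + c" for w t z a
    by blast+
  have space: "transpose L ** M ** L \<in> mat_space (Gz \<theta>')" if "M \<in> mat_space (Gz \<theta>)" for M
    by (rule mat_space_transition[OF assms(5,6,7,8,9,11,14) diff_S diff_v surj sv lam' that])
  obtain \<sigma> where \<sigma>: "bij \<sigma>" and L\<sigma>: "\<And>i. L$i$\<sigma> i \<noteq> 0"
    using invertible_nonzero_transversal[OF L] by blast
  have sub: "Gz \<theta>' $ \<sigma> i $ \<sigma> j \<noteq> 0" if "Gz \<theta> $ i $ j \<noteq> 0" for i j
    by (rule mat_space_conj_entry[OF space that L\<sigma> L\<sigma>])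
  let ?P = "perm_mat \<sigma>"
  have P: "permutation_mat ?P" using \<sigma> by (rule permutation_mat_perm_mat)
  have PP: "transpose ?P *v (?P *v z) = z" "?P *v (transpose ?P *v z) = z" for z :: "real^'dz::_"
    by (simp_all only: matrix_vector_mul_assoc perm_mat_mult_transpose[OF \<sigma>] matrix_vector_mul_lid)
  have first: "\<exists>P. permutation_mat P \<and> P ** Gz \<theta> ** transpose P \<subseteq>\<^sub>m Gz \<theta>'"
    using P perm_mat_conj_subset[OF \<sigma> sub] by blast
  moreover have "z_consistent A \<theta> \<theta>' \<and> lin_equiv A s \<theta> \<theta>' \<and>
     (\<exists>P b C. permutation_mat P \<and> invertible C \<and>
        preserving_mat (Gz \<theta>) C \<and> preserving_mat (transpose (Gz \<theta>)) C \<and>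
        (\<forall>z. C *v (transpose P *v ?S z) + b \<in> range ?S \<and>
             transition \<theta> \<theta>' z = inv ?S (C *v (transpose P *v ?S z) + b)))"
    if sparse: "norm0 (Gz \<theta>') \<le> norm0 (Gz \<theta>)"
  proof (intro conjI)
    note G' = perm_mat_conj_eq_if_sparse[OF \<sigma> sub bin sparse]
    define C where "C = L ** ?P"
    \<comment> \<open>Column \<open>k\<close> of \<open>C\<close> is column
      \<open>\<sigma> k\<close> of \<open>L\<close>, so the entry test first lands in the graph of
      \<open>\<theta>'\<close> at \<open>(\<sigma> k, \<sigma> l)\<close>. Sparsity identifies that
      entry with the one of \<open>Gz \<theta>\<close> at \<open>(k, l)\<close>.\<close>
    have C_entry: "Gz \<theta> $ k $ l \<noteq> 0" if "Gz \<theta> $ i $ j \<noteq> 0" "C$i$k \<noteq> 0" "C$j$l \<noteq> 0" for i j k l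
    proof -
      have "Gz \<theta>' $ \<sigma> k $ \<sigma> l \<noteq> 0"
        by (rule mat_space_conj_entry[OF space that(1)]) (use that in \<open>simp_all add: C_def mult_perm_mat\<close>)
      then show ?thesis by (simp add: G'(1))
    qed
    have C_diag: "C$i$i \<noteq> 0" for i using L\<sigma> by (simp add: C_def mult_perm_mat)
    have pres: "preserving_mat (Gz \<theta>) H" "preserving_mat (transpose (Gz \<theta>)) H"
      if "\<And>i j. H$i$j \<noteq> 0 \<Longrightarrow> C$i$j \<noteq> 0" for H
      by (rule preserving_mat_conj_transversal[where C = C]; use C_entry C_diag that in blast)+
    have "invertible C"
      unfolding C_def using L perm_mat_mult_transpose[OF \<sigma>] by (intro invertible_mult) (auto simp: invertible_def)
    moreover have "preserving_mat (Gz \<theta>) C" "preserving_mat (transpose (Gz \<theta>)) C"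
      using pres[of C] by blast+
    moreover have CP: "C *v (transpose ?P *v ?S z) + b = ?S (v z)" for z
      by (simp only: C_def sv PP matrix_vector_mul_assoc[symmetric])
    ultimately show "\<exists>P b C. permutation_mat P \<and> invertible C \<and>
        preserving_mat (Gz \<theta>) C \<and> preserving_mat (transpose (Gz \<theta>)) C \<and>
        (\<forall>z. C *v (transpose P *v ?S z) + b \<in> range ?S \<and>
             transition \<theta> \<theta>' z = inv ?S (C *v (transpose P *v ?S z) + b))"
      using P inj_S by (intro exI[of _ ?P] exI[of _ b] exI[of _ C]) (simp add: CP v_def)
    show "lin_equiv A s \<theta> \<theta>'"
      using diff(1) L sv unfolding lin_equiv_def v_def by blast
    \<comment> \<open>Forced by \<open>v = c \<circ> P^T\<close>. When the statistics differ between
      coordinates, \<open>c\<close> need not be \<open>s^-1(C s(z) + b)\<close>, but its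
      dependencies are still bounded by the pattern of \<open>C\<close>.\<close>
    define c where "c z = v (?P *v z)" for z
    have Sc: "?S (c z) = L *v ?S (?P *v z) + b" for z by (simp add: c_def sv)
    have "diffeo UNIV UNIV ((*v) ?P)"
    proof (rule diffeo_linear[where g = "(*v) (transpose ?P)"])
      show "(*v) ?P \<circ> (*v) (transpose ?P) = id" "(*v) (transpose ?P) \<circ> (*v) ?P = id"
        by (simp_all only: fun_eq_iff comp_apply PP id_apply simp_thms)
    qed (rule matrix_vector_mul_linear)+
    from diffeo_comp[OF this v] have "diffeo UNIV UNIV c"
      by (simp add: c_def[abs_def] comp_def)
    moreover have "preserving_fun (Gz \<theta>) c" "preserving_fun (transpose (Gz \<theta>)) c"
      unfolding preserving_fun_def C_def[symmetric]
      by (rule pres; unfold C_def; erule dependency_graph_quasi_linear[OF inj_S \<sigma> Sc])+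
    moreover have "transition \<theta> \<theta>' = c \<circ> (\<lambda>z. transpose ?P *v z)"
      by (simp only: fun_eq_iff comp_apply c_def PP v_def simp_thms)
    ultimately show "z_consistent A \<theta> \<theta>'"
      unfolding z_consistent_def using P diff(1) G'(2) by blast
  qed
  ultimately show ?thesis by blast
qed

end
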